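(* Let $H$ be a separable infinite-dimensional Hilbert space and let $\alpha$ be a non-principal ultrafilter on $\mathbb{N}$. If $\alpha$ is a quasi P-point, then $\mathscr{F}_\alpha(B(H))$ is trivial, i.e. $\mathscr{F}_\alpha(B(H))=\mathbb{C}$.
   Context: $B(H)$ is the algebra of bounded linear operators on the (complex) Hilbert space $H$. Ultrapower and commutant: for a unital $C^*$-algebra $A$ and a non-principal ultrafilter $\alpha$ on $\mathbb{N}$, let $\mathscr{A}_\infty=\{(x_n)\in\prod_n A:\sup_n\|x_n\|<\infty\}$ and $\mathscr{N}_\alpha=\{(x_n)\in\mathscr{A}_\infty:\lim_{n\to\alpha}\|x_n\|=0\}$. The ultrapower is the $C^*$-algebra $\mathscr{C}_\alpha(A)=\mathscr{A}_\infty/\mathscr{N}_\alpha$. $A$ is identified with the subalgebra of classes of constant sequences, and $\mathscr{F}_\alpha(A)=\{\mathbf b\in\mathscr{C}_\alpha(A):\mathbf b\mathbf a=\mathbf a\mathbf b\ \text{for all }\mathbf a\in A\}$. It is called trivial if it equals $\mathbb{C}$ (scalar multiples of the unit). Quasi P-points: "$A_n\downarrow\emptyset$ in $\alpha$" means that $(A_n)_{n\in\mathbb{N}}$ is a decreasing sequence of members of $\alpha$ with $\bigcap_nA_n=\emptyset$. Let $\mathscr{D}$ be the diagonal of $\mathbb{N}^2$. Uniformities are understood to be separated (the intersection of all entourages is $\mathscr{D}$), so that a uniformity with a countable base is induced by a metric. A non-principal ultrafilter $\alpha$ on $\mathbb{N}$ is a quasi P-point if for every countable decreasing base $(\mathscr{E}_k)_{k\in\mathbb{N}}$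 of a uniformity on $\mathbb{N}$ at least one of the following holds: (i) there exist $X\in\alpha$ and $k\in\mathbb{N}$ such that $(X^2\cap\mathscr{E}_k)\setminus\mathscr{D}=\emptyset$; (ii) for every $k\in\mathbb{N}$ there exists $X\in\alpha$ such that $X^2\subset\mathscr{E}_k$; (iii) for every $A_n\downarrow\emptyset$ in $\alpha$ and every $k\in\mathbb{N}$ there exists $X\in\alpha$ such that for every $n\in\mathbb{N}$ the set $\{i\in X:\exists j\in A_n \text{ with }(i,j)\in\mathscr{E}_k\}$ is cofinite in $X$. *)

theory Defs
  imports "HOL-Analysis.Analysis" "HOL-Algebra.QuotRing"
begin

section \<open>Complex Hilbert spaces\<close>

class complex_vector = real_vector +
  fixes scaleC :: "complex \<Rightarrow> 'a \<Rightarrow> 'a"  (infixr \<open>*\<^sub>C\<close> 75)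
  assumes scaleC_add_right: "c *\<^sub>C (x + y) = c *\<^sub>C x + c *\<^sub>C y"
    and scaleC_add_left: "(c + d) *\<^sub>C x = c *\<^sub>C x + d *\<^sub>C x"
    and scaleC_scaleC: "c *\<^sub>C d *\<^sub>C x = (c * d) *\<^sub>C x"
    and scaleC_one: "1 *\<^sub>C x = x"
    and scaleR_scaleC: "r *\<^sub>R x = complex_of_real r *\<^sub>C x"

global_interpretation complex_vector:
  vector_space "scaleC :: complex \<Rightarrow> 'a \<Rightarrow> 'a::complex_vector"
  by standard (simp_all add: scaleC_add_right scaleC_add_left scaleC_scaleC scaleC_one)

text \<open>The inner product is linear in its second argument.\<close>

class complex_hilbert_space = complex_vector + banach +
  fixes cinner :: "'a \<Rightarrow> 'a \<Rightarrow> complex"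
  assumes cinner_commute: "cinner x y = cnj (cinner y x)"
    and cinner_add_right: "cinner x (y + z) = cinner x y + cinner x z"
    and cinner_scaleC_right: "cinner x (c *\<^sub>C y) = c * cinner x y"
    and cinner_ge_zero: "0 \<le> Re (cinner x x)"
    and cinner_eq_zero_iff: "cinner x x = 0 \<longleftrightarrow> x = 0"
    and norm_eq_sqrt_cinner: "norm x = sqrt (Re (cinner x x))"

lemma cinner_add_left:
  "cinner (x + y) z = cinner x z + cinner y (z::'a::complex_hilbert_space)"
  by (metis cinner_commute cinner_add_right complex_cnj_add)

lemma cinner_scaleC_left:
  "cinner (c *\<^sub>C x) (y::'a::complex_hilbert_space) = cnj c * cinner x y"
  by (metis cinner_commute cinner_scaleC_right complex_cnj_mult)

lemma cinner_zero_right [simp]: "cinner x (0::'a::complex_hilbert_space) = 0"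
  using cinner_add_right[of x 0 0] by simp

lemma cinner_zero_left [simp]: "cinner (0::'a::complex_hilbert_space) x = 0"
  using cinner_add_left[of 0 0 x] by simp

lemma cinner_minus_right: "cinner x (- (y::'a::complex_hilbert_space)) = - cinner x y"
  using cinner_add_right[of x y "-y"] by (simp add: add_eq_0_iff)

lemma cinner_minus_left: "cinner (- (x::'a::complex_hilbert_space)) y = - cinner x y"
  using cinner_add_left[of x "-x" y] by (simp add: add_eq_0_iff)

lemma cinner_diff_right:
  "cinner x (y - z) = cinner x y - cinner x (z::'a::complex_hilbert_space)"
  using cinner_add_right[of x y "-z"] by (simp add: cinner_minus_right)

lemma cinner_diff_left:
  "cinner (x - y) z = cinner x z - cinner y (z::'a::complex_hilbert_space)"
  using cinner_add_left[of x "-y" z] by (simp add: cinner_minus_left)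

lemma cinner_self: "cinner x x = complex_of_real ((norm (x::'a::complex_hilbert_space))\<^sup>2)"
proof -
  have "Im (cinner x x) = 0"
    using arg_cong[OF cinner_commute[of x x], of Im] by simp
  moreover have "Re (cinner x x) = (norm x)\<^sup>2"
    by (simp add: norm_eq_sqrt_cinner cinner_ge_zero)
  ultimately show ?thesis by (simp add: complex_eq_iff)
qed

lemma norm_add_sq:
  "(norm (x + y))\<^sup>2 = (norm x)\<^sup>2 + 2 * Re (cinner x y) + (norm (y::'a::complex_hilbert_space))\<^sup>2"
proof -
  have "cinner (x + y) (x + y) = cinner x x + cinner x y + cinner y x + cinner y y"
    by (simp add: cinner_add_left cinner_add_right)
  then have "Re (cinner (x + y) (x + y))
      = Re (cinner x x) + Re (cinner x y) + Re (cinner y x) + Re (cinner y y)"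
    by simp
  moreover have "Re (cinner y x) = Re (cinner x y)"
    by (subst cinner_commute) simp
  ultimately show ?thesis by (simp add: cinner_self)
qed

lemma norm_scaleC: "norm (c *\<^sub>C x) = cmod c * norm (x::'a::complex_hilbert_space)"
proof -
  have "cinner (c *\<^sub>C x) (c *\<^sub>C x) = (c * cnj c) * cinner x x"
    by (simp add: cinner_scaleC_left cinner_scaleC_right)
  then have "complex_of_real ((norm (c *\<^sub>C x))\<^sup>2) = complex_of_real ((cmod c)\<^sup>2 * (norm x)\<^sup>2)"
    by (simp only: cinner_self complex_norm_square of_real_mult)
  then have "(norm (c *\<^sub>C x))\<^sup>2 = (cmod c * norm x)\<^sup>2"
    by (simp only: of_real_eq_iff power_mult_distrib)
  then show ?thesis by simp
qed

lemma parallelogram: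
  "(norm (x + y))\<^sup>2 + (norm (x - y))\<^sup>2 = 2 * (norm x)\<^sup>2 + 2 * (norm (y::'a::complex_hilbert_space))\<^sup>2"
  using norm_add_sq[of x y] norm_add_sq[of x "-y"] by (simp add: cinner_minus_right)

lemma cinner_zero_of_minimal:
  fixes x y :: "'a::complex_hilbert_space"
  assumes "\<And>t. norm x \<le> norm (x + t *\<^sub>C y)"
  shows "cinner x y = 0"
proof -
  define a where "a = cinner x y"
  define s where "s = 1 / ((norm y)\<^sup>2 + 1)"
  have pos: "(norm y)\<^sup>2 + 1 > 0" by (simp add: add_nonneg_pos)
  then have s: "s > 0" by (simp add: s_def)
  have ss: "s * (norm y)\<^sup>2 \<le> 1"
    using pos by (simp add: s_def)
  define t where "t = - complex_of_real s * cnj a"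
  have "cinner x (t *\<^sub>C y) = - complex_of_real (s * (cmod a)\<^sup>2)"
    by (simp only: cinner_scaleC_right t_def of_real_mult complex_norm_square flip: a_def)
      (simp add: mult_ac)
  then have re: "Re (cinner x (t *\<^sub>C y)) = - (s * (cmod a)\<^sup>2)"
    by simp
  have nt: "norm (t *\<^sub>C y) = s * cmod a * norm y"
    using s by (simp add: norm_scaleC t_def norm_mult)
  have "(norm x)\<^sup>2 \<le> (norm (x + t *\<^sub>C y))\<^sup>2"
    using assms by (simp add: power_mono)
  also have "\<dots> = (norm x)\<^sup>2 - 2 * (s * (cmod a)\<^sup>2) + s * (cmod a)\<^sup>2 * (s * (norm y)\<^sup>2)"
    unfolding norm_add_sq re nt by (simp add: power2_eq_square algebra_simps)
  also have "\<dots> \<le> (norm x)\<^sup>2 - 2 * (s * (cmod a)\<^sup>2) + s * (cmod a)\<^sup>2 * 1"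
    using s ss by (intro add_left_mono mult_left_mono) auto
  finally have "s * (cmod a)\<^sup>2 \<le> 0" by simp
  then have "(cmod a)\<^sup>2 \<le> 0" using s by (simp add: mult_le_0_iff)
  then show ?thesis by (simp add: a_def)
qed

lemma riesz_representation:
  fixes f :: "'a::complex_hilbert_space \<Rightarrow> complex"
  assumes blin: "bounded_linear f" and fC: "\<And>c x. f (c *\<^sub>C x) = c * f x"
  shows "\<exists>z. \<forall>x. f x = cinner z x"
proof (cases "\<forall>x. f x = 0")
  case True
  then show ?thesis by (intro exI[of _ 0]) simp
next
  case False
  then obtain u where u: "f u \<noteq> 0" by blast
  interpret f: bounded_linear f by fact
  define S where "S = {x. f x = 1}"
  have "(1 / f u) *\<^sub>C u \<in> S" using u by (simp add: S_def fC)
  then have ne: "S \<noteq> {}" by blast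
  define d where "d = Inf (norm ` S)"
  have bdd: "bdd_below (norm ` S)" by (rule bdd_belowI[of _ 0]) auto
  have d_le: "d \<le> norm x" if "x \<in> S" for x
    unfolding d_def using that bdd by (intro cInf_lower) auto
  have d0: "0 \<le> d" unfolding d_def using ne by (intro cInf_greatest) auto
  have "\<exists>x\<in>S. norm x < d + 1 / real (Suc n)" for n
  proof -
    have "Inf (norm ` S) < d + 1 / real (Suc n)" by (simp add: d_def)
    then show ?thesis using cInf_lessD[of "norm ` S"] ne by blast
  qed
  then obtain X where XS: "\<And>n. X n \<in> S" and Xn: "\<And>n. norm (X n) < d + 1 / real (Suc n)"
    by metis
  have limn: "(\<lambda>n. d + 1 / real (Suc n)) \<longlonglongrightarrow> d"
    using tendsto_add[OF tendsto_const LIMSEQ_inverse_real_of_nat, of d]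
    by (simp add: inverse_eq_divide)
  have "(\<lambda>n. (d + 1 / real (Suc n))\<^sup>2) \<longlonglongrightarrow> d\<^sup>2"
    using limn by (rule tendsto_power)
  then have lim2: "\<exists>N. \<forall>n\<ge>N. (d + 1 / real (Suc n))\<^sup>2 < d\<^sup>2 + e" if "e > 0" for e
    using order_tendstoD(2)[of _ "d\<^sup>2" sequentially "d\<^sup>2 + e"] that
    by (auto simp: eventually_sequentially)
  have "Cauchy X"
  proof (rule metric_CauchyI)
    fix e :: real assume e: "e > 0"
    obtain N where N: "\<And>n. n \<ge> N \<Longrightarrow> (d + 1 / real (Suc n))\<^sup>2 < d\<^sup>2 + e\<^sup>2 / 4"
      using lim2[of "e\<^sup>2 / 4"] e by auto
    have nX: "(norm (X n))\<^sup>2 < d\<^sup>2 + e\<^sup>2 / 4" if "n \<ge> N" for n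
    proof -
      have "(norm (X n))\<^sup>2 \<le> (d + 1 / real (Suc n))\<^sup>2"
        using Xn[of n] by (intro power_mono) auto
      then show ?thesis using N[OF that] by simp
    qed
    have "dist (X m) (X n) < e" if mn: "m \<ge> N" "n \<ge> N" for m n
    proof -
      have "f ((1/2) *\<^sub>R (X m + X n)) = 1"
        using XS[of m] XS[of n] by (simp add: f.scaleR f.add S_def scaleR_conv_of_real)
      then have "d \<le> norm ((1/2) *\<^sub>R (X m + X n))" by (intro d_le) (simp only: S_def mem_Collect_eq)
      then have "2 * d \<le> norm (X m + X n)" by simp
      then have "(2 * d)\<^sup>2 \<le> (norm (X m + X n))\<^sup>2" using d0 by (intro power_mono) auto
      then have "(norm (X m - X n))\<^sup>2 < e\<^sup>2"
        using parallelogram[of "X m" "X n"] nX[OF mn(1)] nX[OF mn(2)] by simp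
      then show ?thesis using e by (simp add: dist_norm power2_less_imp_less)
    qed
    then show "\<exists>M. \<forall>m\<ge>M. \<forall>n\<ge>M. dist (X m) (X n) < e" by blast
  qed
  then obtain x where x: "X \<longlonglongrightarrow> x" by (metis Cauchy_convergent convergent_def)
  have "(\<lambda>n. f (X n)) \<longlonglongrightarrow> f x" using x by (rule f.tendsto)
  then have fx: "f x = 1" using XS by (simp add: S_def LIMSEQ_const_iff)
  have nx: "norm x \<le> d"
    using tendsto_norm[OF x] limn by (rule LIMSEQ_le) (intro exI[of _ 0] allI impI less_imp_le Xn)
  have orth: "cinner x y = 0" if "f y = 0" for y
  proof (rule cinner_zero_of_minimal)
    fix t
    have "x + t *\<^sub>C y \<in> S" using fx that by (simp add: S_def f.add fC)
    then show "norm x \<le> norm (x + t *\<^sub>C y)" by (rule order_trans[OF nx d_le])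
  qed
  have x0: "norm x \<noteq> 0" using fx by (auto simp: f.zero)
  define r where "r = complex_of_real ((norm x)\<^sup>2)"
  have r: "r \<noteq> 0" "cnj r = r" using x0 by (auto simp: r_def)
  have "f y = cinner ((1 / r) *\<^sub>C x) y" for y
  proof -
    have "cinner x (y - f y *\<^sub>C x) = 0"
      by (rule orth) (simp add: f.diff fC fx)
    then have "cinner x y = f y * r"
      by (simp add: cinner_diff_right cinner_scaleC_right cinner_self r_def)
    then show ?thesis using r by (simp add: cinner_scaleC_left)
  qed
  then show ?thesis by blast
qed

lemma norm_cinner_le: "cmod (cinner x y) \<le> norm x * norm (y::'a::complex_hilbert_space)"
proof (cases "norm x = 0")
  case True
  then show ?thesis by simp
next
  case False
  define a where "a = cinner x y / complex_of_real ((norm x)\<^sup>2)"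
  define w where "w = y - a *\<^sub>C x"
  have "cinner x w = 0"
    using False by (simp add: w_def a_def cinner_diff_right cinner_scaleC_right cinner_self)
  then have "cinner (a *\<^sub>C x) w = 0" by (simp add: cinner_scaleC_left)
  then have "(norm (a *\<^sub>C x + w))\<^sup>2 = (norm (a *\<^sub>C x))\<^sup>2 + (norm w)\<^sup>2"
    by (simp add: norm_add_sq)
  then have "(norm (a *\<^sub>C x))\<^sup>2 \<le> (norm y)\<^sup>2" by (simp add: w_def)
  then have "norm (a *\<^sub>C x) \<le> norm y" by (rule power2_le_imp_le) simp
  moreover have "norm (a *\<^sub>C x) = cmod (cinner x y) / norm x"
    using False by (simp add: norm_scaleC a_def norm_divide power2_eq_square norm_mult)
  ultimately have "cmod (cinner x y) / norm x \<le> norm y" by simp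
  then show ?thesis using False by (simp add: pos_divide_le_eq mult.commute)
qed

lemma cinner_ext:
  assumes "\<And>x. cinner y x = cinner z (x::'a::complex_hilbert_space)"
  shows "y = z"
proof -
  have "cinner (y - z) (y - z) = 0" by (simp add: cinner_diff_left assms)
  then show ?thesis by (simp add: cinner_eq_zero_iff)
qed


section \<open>Unital C*-algebras\<close>

text \<open>The algebra may be zero: no axiom requires the unit to be nonzero.\<close>

class cstar_algebra = complex_vector + real_normed_algebra + banach + monoid_mult +
  fixes star :: "'a \<Rightarrow> 'a"
  assumes mult_scaleC_left: "(c *\<^sub>C x) * y = c *\<^sub>C (x * y)"
    and mult_scaleC_right: "x * (c *\<^sub>C y) = c *\<^sub>C (x * y)"
    and norm_scaleC_eq: "norm (c *\<^sub>C x) = cmod c * norm x"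
    and star_star: "star (star x) = x"
    and star_add: "star (x + y) = star x + star y"
    and star_scaleC: "star (c *\<^sub>C x) = cnj c *\<^sub>C star x"
    and star_mult: "star (x * y) = star y * star x"
    and cstar_identity: "norm (star x * x) = (norm x)\<^sup>2"


section \<open>The C*-algebra of bounded operators\<close>

text \<open>\<^typ>\<open>'a \<Rightarrow>\<^sub>L 'b\<close> consists of the bounded real-linear maps; complex linearity is
  added here.\<close>

typedef (overloaded) 'a bop =
  "{T :: 'a::complex_hilbert_space \<Rightarrow>\<^sub>L 'a. \<forall>c x. blinfun_apply T (c *\<^sub>C x) = c *\<^sub>C blinfun_apply T x}"
  morphisms blinfun_of_bop Bop
  by (intro exI[of _ 0]) simp

setup_lifting type_definition_bop

lift_definition bop_apply :: "'a::complex_hilbert_space bop \<Rightarrow> 'a \<Rightarrow> 'a" is blinfun_apply .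

lemma bop_eqI: "(\<And>x. bop_apply S x = bop_apply T x) \<Longrightarrow> S = T"
  by transfer (simp add: blinfun_eqI)

lemma bop_apply_scaleC: "bop_apply T (c *\<^sub>C x) = c *\<^sub>C bop_apply T x"
  by transfer simp

lemma bounded_linear_bop_apply: "bounded_linear (bop_apply T)"
  by transfer (rule blinfun.bounded_linear_right)

instantiation bop :: (complex_hilbert_space) real_normed_vector
begin

lift_definition zero_bop :: "'a bop" is 0 by simp

lift_definition plus_bop :: "'a bop \<Rightarrow> 'a bop \<Rightarrow> 'a bop" is "(+)"
  by (simp add: blinfun.add_left scaleC_add_right)

lift_definition uminus_bop :: "'a bop \<Rightarrow> 'a bop" is uminus
  by (simp add: blinfun.minus_left)

lift_definition minus_bop :: "'a bop \<Rightarrow> 'a bop \<Rightarrow> 'a bop" is "(-)"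
  by (simp add: blinfun.diff_left complex_vector.scale_right_diff_distrib)

lift_definition scaleR_bop :: "real \<Rightarrow> 'a bop \<Rightarrow> 'a bop" is "(*\<^sub>R)"
  by (simp add: blinfun.scaleR_left scaleR_scaleC scaleC_scaleC mult.commute)

lift_definition norm_bop :: "'a bop \<Rightarrow> real" is norm .

definition dist_bop :: "'a bop \<Rightarrow> 'a bop \<Rightarrow> real"
  where "dist_bop S T = norm (S - T)"

definition uniformity_bop :: "('a bop \<times> 'a bop) filter"
  where "uniformity_bop = (INF e\<in>{0 <..}. principal {(x, y). dist x y < e})"

definition open_bop :: "'a bop set \<Rightarrow> bool"
  where "open_bop U = (\<forall>x\<in>U. \<forall>\<^sub>F (x', y) in uniformity. x' = x \<longrightarrow> y \<in> U)"

definition sgn_bop :: "'a bop \<Rightarrow> 'a bop"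
  where "sgn_bop T = inverse (norm T) *\<^sub>R T"

instance
  apply standard
  unfolding dist_bop_def uniformity_bop_def open_bop_def sgn_bop_def
  apply (rule refl | (transfer, simp add: algebra_simps norm_triangle_ineq))+
  done

end

lemma norm_bop_apply: "norm (bop_apply T x) \<le> norm T * norm x"
  by transfer (rule norm_blinfun)

lemma norm_bop_bound:
  "0 \<le> b \<Longrightarrow> (\<And>x. norm (bop_apply T x) \<le> b * norm x) \<Longrightarrow> norm T \<le> b"
  by transfer (rule norm_blinfun_bound)

instance bop :: (complex_hilbert_space) banach
proof
  fix X :: "nat \<Rightarrow> 'a bop"
  assume X: "Cauchy X"
  have d: "dist (blinfun_of_bop S) (blinfun_of_bop T) = dist S T" for S T :: "'a bop"
    unfolding dist_norm by transfer (rule refl)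
  have "Cauchy (\<lambda>n. blinfun_of_bop (X n))"
    using X by (simp add: Cauchy_def d)
  then obtain L where L: "(\<lambda>n. blinfun_of_bop (X n)) \<longlonglongrightarrow> L"
    by (metis Cauchy_convergent convergent_def)
  have app: "(\<lambda>n. bop_apply (X n) x) \<longlonglongrightarrow> blinfun_apply L x" for x
    using L unfolding bop_apply.rep_eq by (intro tendsto_intros)
  have "blinfun_apply L (c *\<^sub>C x) = c *\<^sub>C blinfun_apply L x" for c x
  proof (rule LIMSEQ_unique[OF app])
    have "bounded_linear (\<lambda>y::'a. c *\<^sub>C y)"
      by (rule bounded_linear_intro[where K = "cmod c"])
        (simp_all add: scaleC_add_right scaleR_scaleC scaleC_scaleC norm_scaleC mult.commute)
    then show "(\<lambda>n. bop_apply (X n) (c *\<^sub>C x)) \<longlonglongrightarrow> c *\<^sub>C blinfun_apply L x"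
      unfolding bop_apply_scaleC by (rule bounded_linear.tendsto[OF _ app])
  qed
  then obtain T where T: "blinfun_of_bop T = L"
    using Bop_inverse[of L] by blast
  have "X \<longlonglongrightarrow> T"
    using L unfolding T[symmetric] by (simp add: lim_sequentially d)
  then show "convergent X" by (auto simp: convergent_def)
qed

lemma adjoint_exists:
  fixes T :: "'a::complex_hilbert_space bop"
  shows "\<exists>S. \<forall>x y. cinner (bop_apply S y) x = cinner y (bop_apply T x)"
proof -
  interpret T: bounded_linear "bop_apply T" by (rule bounded_linear_bop_apply)
  have "\<exists>z. \<forall>x. cinner y (bop_apply T x) = cinner z x" for y
  proof (rule riesz_representation)
    show "bounded_linear (\<lambda>x. cinner y (bop_apply T x))"
    proof (rule bounded_linear_intro)
      show "norm (cinner y (bop_apply T x)) \<le> norm x * (norm y * norm T)" for x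
        using order_trans[OF norm_cinner_le[of y "bop_apply T x"]
            mult_left_mono[OF norm_bop_apply[of T x] norm_ge_zero[of y]]]
        by (simp add: mult_ac)
    qed (simp_all add: T.add T.scaleR cinner_add_right scaleR_scaleC[where 'a='a]
        bop_apply_scaleC cinner_scaleC_right scaleR_conv_of_real)
  qed (simp add: bop_apply_scaleC cinner_scaleC_right)
  then obtain g where g: "\<And>x y. cinner (g y) x = cinner y (bop_apply T x)" by metis
  have gadd: "g (x + y) = g x + g y" for x y
    by (rule cinner_ext) (simp add: g cinner_add_left)
  have gC: "g (c *\<^sub>C x) = c *\<^sub>C g x" for c x
    by (rule cinner_ext) (simp add: g cinner_scaleC_left)
  have gb: "norm (g y) \<le> norm T * norm y" for y
  proof (cases "g y = 0")
    case False
    have "complex_of_real ((norm (g y))\<^sup>2) = cinner y (bop_apply T (g y))"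
      by (simp add: cinner_self flip: g)
    then have "(norm (g y))\<^sup>2 = cmod (cinner y (bop_apply T (g y)))"
      by (metis norm_of_real abs_of_nonneg zero_le_power2)
    also have "\<dots> \<le> norm y * (norm T * norm (g y))"
      by (rule order_trans[OF norm_cinner_le mult_left_mono[OF norm_bop_apply norm_ge_zero]])
    finally have "norm (g y) * norm (g y) \<le> (norm T * norm y) * norm (g y)"
      by (simp add: power2_eq_square mult_ac)
    then show ?thesis using False by simp
  qed simp
  have bl: "bounded_linear g"
    using gb by (intro bounded_linear_intro[where K = "norm T"])
      (simp_all add: gadd gC scaleR_scaleC mult.commute)
  then have "Blinfun g \<in> {T. \<forall>c x. blinfun_apply T (c *\<^sub>C x) = c *\<^sub>C blinfun_apply T x}"
    by (simp add: bounded_linear_Blinfun_apply gC)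
  then have "bop_apply (Bop (Blinfun g)) = g"
    by (simp add: bop_apply.rep_eq Bop_inverse bounded_linear_Blinfun_apply bl)
  then show ?thesis using g by (intro exI[of _ "Bop (Blinfun g)"]) simp
qed

instantiation bop :: (complex_hilbert_space) cstar_algebra
begin

lift_definition one_bop :: "'a bop" is id_blinfun by simp

lift_definition times_bop :: "'a bop \<Rightarrow> 'a bop \<Rightarrow> 'a bop" is "(o\<^sub>L)" by simp

definition scaleC_bop :: "complex \<Rightarrow> 'a bop \<Rightarrow> 'a bop"
  where "scaleC_bop c T = Bop (Blinfun (\<lambda>x. c *\<^sub>C bop_apply T x))"

definition star_bop :: "'a bop \<Rightarrow> 'a bop"
  where "star_bop T = (THE S. \<forall>x y. cinner (bop_apply S y) x = cinner y (bop_apply T x))"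

lemma bop_apply_simps:
  "bop_apply 0 x = (0::'a)"
  "bop_apply (S + T) x = bop_apply S x + bop_apply T (x::'a)"
  "bop_apply (r *\<^sub>R T) x = r *\<^sub>R bop_apply T x"
  "bop_apply 1 x = x"
  "bop_apply (S * T) x = bop_apply S (bop_apply T x)"
  by (transfer, simp add: blinfun.add_left blinfun.scaleR_left)+

lemma bop_apply_scaleC_left: "bop_apply (c *\<^sub>C T) x = c *\<^sub>C bop_apply T (x::'a)"
proof -
  interpret T: bounded_linear "bop_apply T" by (rule bounded_linear_bop_apply)
  have bl: "bounded_linear (\<lambda>x. c *\<^sub>C bop_apply T x)"
  proof (rule bounded_linear_intro)
    show "norm (c *\<^sub>C bop_apply T x) \<le> norm x * (cmod c * norm T)" for x
      using mult_left_mono[OF norm_bop_apply[of T x], of "cmod c"]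
      by (simp add: norm_scaleC mult_ac)
  qed (simp_all add: T.add T.scaleR scaleC_add_right scaleR_scaleC scaleC_scaleC bop_apply_scaleC
      mult.commute)
  have "Blinfun (\<lambda>x. c *\<^sub>C bop_apply T x)
      \<in> {T. \<forall>c x. blinfun_apply T (c *\<^sub>C x) = c *\<^sub>C blinfun_apply T x}"
    by (simp add: bounded_linear_Blinfun_apply[OF bl] bop_apply_scaleC scaleC_scaleC mult.commute)
  then show ?thesis
    by (simp add: scaleC_bop_def bop_apply.rep_eq Bop_inverse bounded_linear_Blinfun_apply[OF
          bl[unfolded bop_apply.rep_eq]])
qed

lemma cinner_star_left: "cinner (bop_apply (star T) y) x = cinner y (bop_apply T (x::'a))"
proof -
  have "\<exists>!S. \<forall>x y. cinner (bop_apply S y) x = cinner y (bop_apply T x)"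
  proof (rule ex_ex1I[OF adjoint_exists])
    fix S S' :: "'a bop"
    assume "\<forall>x y. cinner (bop_apply S y) x = cinner y (bop_apply T x)"
      and "\<forall>x y. cinner (bop_apply S' y) x = cinner y (bop_apply T x)"
    then show "S = S'" by (intro bop_eqI cinner_ext) simp
  qed
  from theI'[OF this] show ?thesis by (simp add: star_bop_def)
qed

lemma cinner_star_right: "cinner x (bop_apply (star T) y) = cinner (bop_apply T x) (y::'a)"
  by (metis cinner_commute cinner_star_left)

lemma norm_times_bop: "norm (S * T) \<le> norm S * norm (T::'a bop)"
  by transfer (rule norm_blinfun_compose)

lemma norm_sq_le_star: "(norm T)\<^sup>2 \<le> norm (star T * (T::'a bop))"
proof -
  have "norm T \<le> sqrt (norm (star T * T))"
  proof (rule norm_bop_bound)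
    fix x :: 'a
    have "complex_of_real ((norm (bop_apply T x))\<^sup>2) = cinner (bop_apply (star T * T) x) x"
      by (simp add: bop_apply_simps cinner_star_left cinner_self)
    then have "(norm (bop_apply T x))\<^sup>2 = cmod (cinner (bop_apply (star T * T) x) x)"
      by (metis norm_of_real abs_of_nonneg zero_le_power2)
    also have "\<dots> \<le> (norm (star T * T) * norm x) * norm x"
      by (rule order_trans[OF norm_cinner_le mult_right_mono[OF norm_bop_apply norm_ge_zero]])
    also have "\<dots> = (sqrt (norm (star T * T)) * norm x)\<^sup>2"
      by (simp add: power_mult_distrib power2_eq_square)
    finally show "norm (bop_apply T x) \<le> sqrt (norm (star T * T)) * norm x"
      by (rule power2_le_imp_le) simp
  qed simp
  then have "(norm T)\<^sup>2 \<le> (sqrt (norm (star T * T)))\<^sup>2" by (intro power_mono) auto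
  then show ?thesis by simp
qed

lemma star_star_bop: "star (star T) = (T::'a bop)"
  by (intro bop_eqI cinner_ext) (simp add: cinner_star_left cinner_star_right)

lemma norm_le_star: "norm T \<le> norm (star (T::'a bop))"
proof (cases "T = 0")
  case False
  have "norm T * norm T \<le> norm (star T) * norm T"
    using order_trans[OF norm_sq_le_star norm_times_bop] by (simp add: power2_eq_square)
  then show ?thesis using False by simp
qed simp

instance
proof
  fix S T U :: "'a bop" and c d :: complex and r :: real
  note app = bop_apply_simps bop_apply_scaleC_left
  have lin: "bop_apply S (x + y) = bop_apply S x + bop_apply S y"
    "bop_apply S (r *\<^sub>R x) = r *\<^sub>R bop_apply S x" for S :: "'a bop" and x y r
    using bounded_linear_bop_apply[of S] by (simp_all add: linear_simps)
  note app' = app lin bop_apply_scaleC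
  show "c *\<^sub>C (S + T) = c *\<^sub>C S + c *\<^sub>C T"
    by (rule bop_eqI) (simp add: app' scaleC_add_right)
  show "(c + d) *\<^sub>C S = c *\<^sub>C S + d *\<^sub>C S"
    by (rule bop_eqI) (simp add: app' scaleC_add_left)
  show "c *\<^sub>C d *\<^sub>C S = (c * d) *\<^sub>C S"
    by (rule bop_eqI) (simp add: app' scaleC_scaleC)
  show "1 *\<^sub>C S = S"
    by (rule bop_eqI) (simp add: app' scaleC_one)
  show "r *\<^sub>R S = complex_of_real r *\<^sub>C S"
    by (rule bop_eqI) (simp add: app' scaleR_scaleC)
  show "S * T * U = S * (T * U)" by (rule bop_eqI) (simp add: app')
  show "(S + T) * U = S * U + T * U" by (rule bop_eqI) (simp add: app')
  show "S * (T + U) = S * T + S * U" by (rule bop_eqI) (simp add: app')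
  show "r *\<^sub>R S * T = r *\<^sub>R (S * T)" by (rule bop_eqI) (simp add: app')
  show "S * r *\<^sub>R T = r *\<^sub>R (S * T)" by (rule bop_eqI) (simp add: app')
  show "1 * S = S" by (rule bop_eqI) (simp add: app')
  show "S * 1 = S" by (rule bop_eqI) (simp add: app')
  show "norm (S * T) \<le> norm S * norm T" by (rule norm_times_bop)
  show "c *\<^sub>C S * T = c *\<^sub>C (S * T)" by (rule bop_eqI) (simp add: app')
  show "S * c *\<^sub>C T = c *\<^sub>C (S * T)" by (rule bop_eqI) (simp add: app')
  have le: "norm (c *\<^sub>C S) \<le> cmod c * norm S" for c :: complex and S :: "'a bop"
    by (rule norm_bop_bound)
      (simp_all add: app' norm_scaleC mult_left_mono norm_bop_apply mult.assoc)
  show "norm (c *\<^sub>C S) = cmod c * norm S"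
  proof (cases "c = 0")
    case True
    then show ?thesis using le[of c S] by simp
  next
    case False
    have "S = (1 / c) *\<^sub>C (c *\<^sub>C S)"
      using False by (intro bop_eqI) (simp add: app' scaleC_scaleC scaleC_one)
    then have "norm S \<le> cmod (1 / c) * norm (c *\<^sub>C S)" using le by metis
    then have "cmod c * norm S \<le> norm (c *\<^sub>C S)"
      using False by (simp add: norm_divide field_simps)
    then show ?thesis using le[of c S] by simp
  qed
  show "star (star S) = S" by (rule star_star_bop)
  show "star (S + T) = star S + star T"
    by (intro bop_eqI cinner_ext)
      (simp add: app' cinner_star_left cinner_add_left cinner_add_right)
  show "star (c *\<^sub>C S) = cnj c *\<^sub>C star S"
    by (intro bop_eqI cinner_ext)
      (simp add: app' cinner_star_left cinner_scaleC_left cinner_scaleC_right)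
  show "star (S * T) = star T * star S"
    by (intro bop_eqI cinner_ext) (simp add: app' cinner_star_left)
  have "norm (star S) = norm S"
    using norm_le_star[of S] norm_le_star[of "star S"] by (simp add: star_star_bop)
  then show "norm (star S * S) = (norm S)\<^sup>2"
    using norm_sq_le_star[of S] norm_times_bop[of "star S" S] by (simp add: power2_eq_square)
qed

end


section \<open>Ultrafilters\<close>

definition members :: "nat filter \<Rightarrow> nat set set"
  where "members \<alpha> = {A. eventually (\<lambda>n. n \<in> A) \<alpha>}"

definition nonprincipal_ultrafilter :: "nat filter \<Rightarrow> bool"
  where "nonprincipal_ultrafilter \<alpha> \<longleftrightarrow>
    \<alpha> \<noteq> bot \<and> (\<forall>A. A \<in> members \<alpha> \<or> - A \<in> members \<alpha>) \<and> (\<forall>n. \<alpha> \<noteq> principal {n})"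


section \<open>Ultrapower and commutant\<close>

definition bounded_seq_ring :: "(nat \<Rightarrow> 'a::cstar_algebra) ring"
  where "bounded_seq_ring =
    \<lparr>carrier = {x. bdd_above (range (\<lambda>n. norm (x n)))},
     mult = (\<lambda>x y n. x n * y n), one = (\<lambda>n. 1), zero = (\<lambda>n. 0), add = (\<lambda>x y n. x n + y n)\<rparr>"

definition null_seq_ideal :: "nat filter \<Rightarrow> (nat \<Rightarrow> 'a::cstar_algebra) set"
  where "null_seq_ideal \<alpha> =
    {x \<in> carrier bounded_seq_ring. ((\<lambda>n. norm (x n)) \<longlongrightarrow> 0) \<alpha>}"

text \<open>Only the ring structure of the ultrapower is recorded: its norm and involution do not
  enter the definition of the commutant, and its scalars are the classes of the constant
  sequences \<open>c \<cdot> 1\<close>.\<close>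

definition ultrapower :: "nat filter \<Rightarrow> (nat \<Rightarrow> 'a::cstar_algebra) set ring"
  where "ultrapower \<alpha> = bounded_seq_ring Quot null_seq_ideal \<alpha>"

definition const_class :: "nat filter \<Rightarrow> 'a::cstar_algebra \<Rightarrow> (nat \<Rightarrow> 'a) set"
  where "const_class \<alpha> a = null_seq_ideal \<alpha> +>\<^bsub>bounded_seq_ring\<^esub> (\<lambda>n. a)"

definition ultra_commutant :: "nat filter \<Rightarrow> (nat \<Rightarrow> 'a::cstar_algebra) set set"
  where "ultra_commutant \<alpha> =
    {b \<in> carrier (ultrapower \<alpha>).
      \<forall>a. b \<otimes>\<^bsub>ultrapower \<alpha>\<^esub> const_class \<alpha> a = const_class \<alpha> a \<otimes>\<^bsub>ultrapower \<alpha>\<^esub> b}"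

definition ultra_scalars :: "nat filter \<Rightarrow> (nat \<Rightarrow> 'a::cstar_algebra) set set"
  where "ultra_scalars \<alpha> = range (\<lambda>c::complex. const_class \<alpha> (c *\<^sub>C 1))"

lemma bounded_seq_carrier_iff:
  "x \<in> carrier bounded_seq_ring \<longleftrightarrow> (\<exists>K\<ge>0. \<forall>n. norm (x n) \<le> K)"
  unfolding bounded_seq_ring_def bdd_above_def
  by (auto intro: order_trans[OF norm_ge_zero])

lemma ring_bounded_seq_ring: "ring (bounded_seq_ring :: (nat \<Rightarrow> 'a::cstar_algebra) ring)"
proof (rule ringI[OF abelian_groupI monoidI])
  fix x y :: "nat \<Rightarrow> 'a"
  assume x: "x \<in> carrier bounded_seq_ring"
  then obtain K where K: "0 \<le> K" "\<And>n. norm (x n) \<le> K" by (auto simp: bounded_seq_carrier_iff)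
  then have "(\<lambda>n. - x n) \<in> carrier bounded_seq_ring" by (auto simp: bounded_seq_carrier_iff)
  then show "\<exists>z\<in>carrier bounded_seq_ring. z \<oplus>\<^bsub>bounded_seq_ring\<^esub> x = \<zero>\<^bsub>bounded_seq_ring\<^esub>"
    by (rule rev_bexI) (simp add: bounded_seq_ring_def)
  assume "y \<in> carrier bounded_seq_ring"
  then obtain L where L: "0 \<le> L" "\<And>n. norm (y n) \<le> L" by (auto simp: bounded_seq_carrier_iff)
  have "norm (x n + y n) \<le> K + L" for n by (intro norm_triangle_le add_mono K L)
  moreover have "norm (x n * y n) \<le> K * L" for n
    by (intro order_trans[OF norm_mult_ineq] mult_mono K L) simp
  ultimately show "x \<oplus>\<^bsub>bounded_seq_ring\<^esub> y \<in> carrier bounded_seq_ring"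
    and "x \<otimes>\<^bsub>bounded_seq_ring\<^esub> y \<in> carrier bounded_seq_ring"
    using add_nonneg_nonneg[OF K(1) L(1)] mult_nonneg_nonneg[OF K(1) L(1)]
    unfolding bounded_seq_carrier_iff by (auto simp: bounded_seq_ring_def)
qed (auto simp: bounded_seq_ring_def algebra_simps)

lemma ideal_null_seq_ideal:
  "ideal (null_seq_ideal \<alpha> :: (nat \<Rightarrow> 'a::cstar_algebra) set) bounded_seq_ring"
proof -
  let ?R = "bounded_seq_ring :: (nat \<Rightarrow> 'a) ring"
  let ?N = "null_seq_ideal \<alpha> :: (nat \<Rightarrow> 'a) set"
  interpret R: ring ?R by (rule ring_bounded_seq_ring)
  have N: "x \<in> ?N \<longleftrightarrow> x \<in> carrier ?R \<and> (x \<longlongrightarrow> 0) \<alpha>" for x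
    by (auto simp: null_seq_ideal_def tendsto_norm_zero_iff)
  have ops: "x \<oplus>\<^bsub>?R\<^esub> y = (\<lambda>n. x n + y n)" "x \<otimes>\<^bsub>?R\<^esub> y = (\<lambda>n. x n * y n)"
    "\<zero>\<^bsub>?R\<^esub> = (\<lambda>n. 0)" for x y
    by (simp_all add: bounded_seq_ring_def)
  have neg: "\<ominus>\<^bsub>?R\<^esub> x = (\<lambda>n. - x n)" if "x \<in> carrier ?R" for x
  proof -
    have "(\<lambda>n. - x n) \<in> carrier ?R" using that by (simp add: bounded_seq_ring_def)
    then show ?thesis using that by (intro R.minus_equality) (simp_all add: ops)
  qed
  have prod: "((\<lambda>n. x n * y n) \<longlongrightarrow> 0) \<alpha>" "((\<lambda>n. y n * x n) \<longlongrightarrow> 0) \<alpha>"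
    if x: "x \<in> ?N" and y: "y \<in> carrier ?R" for x y :: "nat \<Rightarrow> 'a"
  proof -
    obtain K where K: "\<And>n. norm (y n) \<le> K" using y by (auto simp: bounded_seq_carrier_iff)
    have lim: "((\<lambda>n. norm (x n) * K) \<longlongrightarrow> 0) \<alpha>"
      using x by (intro tendsto_mult_left_zero) (simp add: null_seq_ideal_def)
    have "norm (x n * y n) \<le> norm (x n) * K" for n
      by (rule order_trans[OF norm_mult_ineq mult_left_mono[OF K norm_ge_zero]])
    then show "((\<lambda>n. x n * y n) \<longlongrightarrow> 0) \<alpha>"
      by (intro Lim_null_comparison[OF always_eventually lim] allI)
    have "norm (y n * x n) \<le> norm (x n) * K" for n
      by (subst mult.commute[of "norm (x n)"])
        (rule order_trans[OF norm_mult_ineq mult_right_mono[OF K norm_ge_zero]])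
    then show "((\<lambda>n. y n * x n) \<longlongrightarrow> 0) \<alpha>"
      by (intro Lim_null_comparison[OF always_eventually lim] allI)
  qed
  show ?thesis
  proof (rule idealI[OF ring_bounded_seq_ring])
    show "subgroup ?N (add_monoid ?R)"
    proof (rule R.add.subgroupI)
      show "?N \<subseteq> carrier ?R" by (auto simp: N)
      have "\<zero>\<^bsub>?R\<^esub> \<in> ?N" unfolding N using R.zero_closed by (simp add: ops)
      then show "?N \<noteq> {}" by blast
      show "\<ominus>\<^bsub>?R\<^esub> x \<in> ?N" if "x \<in> ?N" for x
        using that R.a_inv_closed[of x] unfolding N by (auto simp: neg intro: tendsto_eq_intros)
      show "x \<oplus>\<^bsub>?R\<^esub> y \<in> ?N" if "x \<in> ?N" "y \<in> ?N" for x y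
        using that R.a_closed[of x y] unfolding N by (auto simp: ops intro: tendsto_eq_intros)
    qed
    show "x \<otimes>\<^bsub>?R\<^esub> a \<in> ?N" "a \<otimes>\<^bsub>?R\<^esub> x \<in> ?N" if "a \<in> ?N" "x \<in> carrier ?R" for a x
      using that prod[OF that] R.m_closed[of x a] R.m_closed[of a x] unfolding N
      by (auto simp: ops)
  qed
qed

lemma ring_ultrapower: "ring (ultrapower \<alpha>)"
  unfolding ultrapower_def by (rule ideal.quotient_is_ring[OF ideal_null_seq_ideal])


section \<open>Quasi P-points\<close>

definition separated_uniformity :: "(nat \<times> nat) set set \<Rightarrow> bool"
  where "separated_uniformity U \<longleftrightarrow>
    U \<noteq> {} \<and>
    (\<forall>V\<in>U. Id \<subseteq> V) \<and>
    (\<forall>V\<in>U. \<forall>W. V \<subseteq> W \<longrightarrow> W \<in> U) \<and>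
    (\<forall>V\<in>U. \<forall>W\<in>U. V \<inter> W \<in> U) \<and>
    (\<forall>V\<in>U. V\<inverse> \<in> U) \<and>
    (\<forall>V\<in>U. \<exists>W\<in>U. W O W \<subseteq> V) \<and>
    \<Inter>U = Id"

text \<open>The sets \<open>E k\<close> themselves need not be symmetric.\<close>

definition decreasing_uniformity_base :: "(nat \<Rightarrow> (nat \<times> nat) set) \<Rightarrow> bool"
  where "decreasing_uniformity_base E \<longleftrightarrow>
    decseq E \<and>
    (\<exists>U. separated_uniformity U \<and> (\<forall>k. E k \<in> U) \<and> (\<forall>V\<in>U. \<exists>k. E k \<subseteq> V))"

definition decreasing_to_empty :: "nat filter \<Rightarrow> (nat \<Rightarrow> nat set) \<Rightarrow> bool"
  where "decreasing_to_empty \<alpha> A \<longleftrightarrow>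
    decseq A \<and> (\<forall>n. A n \<in> members \<alpha>) \<and> (\<Inter>n. A n) = {}"

definition quasi_P_point :: "nat filter \<Rightarrow> bool"
  where "quasi_P_point \<alpha> \<longleftrightarrow>
    nonprincipal_ultrafilter \<alpha> \<and>
    (\<forall>E. decreasing_uniformity_base E \<longrightarrow>
      (\<exists>X\<in>members \<alpha>. \<exists>k. ((X \<times> X) \<inter> E k) - Id = {}) \<or>
      (\<forall>k. \<exists>X\<in>members \<alpha>. X \<times> X \<subseteq> E k) \<or>
      (\<forall>A. decreasing_to_empty \<alpha> A \<longrightarrow>
        (\<forall>k. \<exists>X\<in>members \<alpha>. \<forall>n. finite (X - {i \<in> X. \<exists>j\<in>A n. (i, j) \<in> E k}))))"

end

theory Submission
  imports Defs
begin

text \<open>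
  Let \<open>b i\<close> be a bounded sequence of operators that commutes with every operator in the limit along
  \<open>\<alpha>\<close>. It suffices that \<open>b\<close> is Cauchy along \<open>\<alpha>\<close>, because its limit is then central. Two
  single operators force most of the structure.

  First, for those \<open>b i\<close> that are not within \<open>\<eta>\<close> of a scalar plus a compact operator, orthonormal
  pairs \<open>x i\<close>, \<open>y i\<close> with \<open>\<langle>x i, b i y i\<rangle>\<close> bounded away from zero can be found arbitrarily far out in a
  basis. Choosing them with disjoint supports, the projection onto the span of the \<open>x i\<close> fails to
  commute with each of these \<open>b i\<close>. So for \<open>\<alpha>\<close>-most \<open>i\<close> the operator \<open>b i\<close> is nearly a scalar outside the
  first \<open>n\<close> basis vectors, for some \<open>n\<close> depending on \<open>i\<close>.

  Second, this \<open>n\<close> cannot tend to infinity along a member \<open>X\<close> of \<open>\<alpha>\<close>, in the sense that each \<open>n\<close>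
  works only for finitely many \<open>i\<close> in \<open>X\<close>. Otherwise one isometry \<open>S\<close>, shifting basis vectors fast
  enough, moves for each such \<open>i\<close> the critical part of the basis into the region where \<open>b i\<close> is
  nearly a scalar to a better precision, and \<open>b i = S* S b i\<close> together with approximate commutation
  makes \<open>b i\<close> nearly scalar too early.

  The uniformity of \<open>\<parallel>b i - b j\<parallel>\<close> now rules out the alternatives to Cauchy. For fixed \<open>n\<close> the
  operators that are nearly scalar beyond \<open>n\<close> are almost totally bounded, so in the discrete case (i)
  each \<open>n\<close> works for finitely many \<open>i\<close> only. In case (iii), if no \<open>n\<close> works \<open>\<alpha>\<close>-often, apply the
  condition to the sets of \<open>i \<ge> n\<close> for which \<open>n\<close> does not work.
\<close>

section \<open>Bounded operators\<close>

lemma star_zero: "star 0 = (0 :: 'a::cstar_algebra)"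
  by (metis add_cancel_left_left star_add)

lemma star_minus: "star (x - y) = star x - star (y :: 'a::cstar_algebra)"
  using star_add[of "x - y" y] by simp

lemma star_one: "star 1 = (1 :: 'a::cstar_algebra)"
  by (metis mult_1_right mult_1_left star_mult star_star)

lemma norm_star: "norm (star T) = norm (T :: 'h::complex_hilbert_space bop)"
  using norm_le_star[of T] norm_le_star[of "star T"] by (simp add: star_star)

lemma bop_apply_diff: "bop_apply (S - T) x = bop_apply S x - bop_apply T (x :: 'h::complex_hilbert_space)"
  by transfer (simp add: blinfun.diff_left)

lemma bop_apply_sum:
  "bop_apply (\<Sum>i\<in>A. T i) x = (\<Sum>i\<in>A. bop_apply (T i) (x :: 'h::complex_hilbert_space))"
  by (induction A rule: infinite_finite_induct) (simp_all add: bop_apply_simps)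

lemmas bop_simps = bop_apply_simps bop_apply_diff bop_apply_scaleC_left bop_apply_scaleC

lemma bop_linear:
  fixes T :: "'h::complex_hilbert_space bop"
  shows "bop_apply T 0 = 0" "bop_apply T (x + y) = bop_apply T x + bop_apply T y"
    "bop_apply T (x - y) = bop_apply T x - bop_apply T y"
    "bop_apply T (\<Sum>i\<in>A. g i) = (\<Sum>i\<in>A. bop_apply T (g i))"
proof -
  interpret bounded_linear "bop_apply T" by (rule bounded_linear_bop_apply)
  show "bop_apply T 0 = 0" "bop_apply T (x + y) = bop_apply T x + bop_apply T y"
    "bop_apply T (x - y) = bop_apply T x - bop_apply T y"
    "bop_apply T (\<Sum>i\<in>A. g i) = (\<Sum>i\<in>A. bop_apply T (g i))"
    by (simp_all add: zero add diff sum)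
qed

lemma cinner_sum_right:
  "cinner x (\<Sum>i\<in>A. g i) = (\<Sum>i\<in>A. cinner x (g i :: 'h::complex_hilbert_space))"
  by (induction A rule: infinite_finite_induct) (simp_all add: cinner_add_right)

lemma cinner_sum_left:
  "cinner (\<Sum>i\<in>A. g i) x = (\<Sum>i\<in>A. cinner (g i :: 'h::complex_hilbert_space) x)"
  by (induction A rule: infinite_finite_induct) (simp_all add: cinner_add_left)

lemma bounded_linear_cinner_right: "bounded_linear (cinner (x :: 'h::complex_hilbert_space))"
  by (rule bounded_linear_intro[where K = "norm x"])
    (simp_all add: cinner_add_right cinner_scaleC_right scaleR_scaleC[where 'a='h]
      scaleR_conv_of_real norm_cinner_le mult.commute[of _ "norm x"])

lemma cinner_eq_zero_commute: "cinner x y = 0 \<longleftrightarrow> cinner y (x :: 'h::complex_hilbert_space) = 0"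
  by (metis cinner_commute complex_cnj_zero)

lemma bop_exists:
  fixes g :: "'h::complex_hilbert_space \<Rightarrow> 'h"
  assumes add: "\<And>x y. g (x + y) = g x + g y" and scale: "\<And>c x. g (c *\<^sub>C x) = c *\<^sub>C g x"
    and bound: "\<And>x. norm (g x) \<le> K * norm x"
  shows "\<exists>T. \<forall>x. bop_apply T x = g x"
proof -
  have bl: "bounded_linear g"
    using bound by (intro bounded_linear_intro[where K = K])
      (simp_all add: add scale scaleR_scaleC mult.commute)
  then have "Blinfun g \<in> {T. \<forall>c x. blinfun_apply T (c *\<^sub>C x) = c *\<^sub>C blinfun_apply T x}"
    by (simp add: bounded_linear_Blinfun_apply scale)
  then have "bop_apply (Bop (Blinfun g)) = g"
    by (simp add: bop_apply.rep_eq Bop_inverse bounded_linear_Blinfun_apply bl)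
  then show ?thesis by metis
qed

text \<open>The ket-bra operator of \<open>x\<close> and \<open>y\<close>, obtained by choice from
  \<open>bop_exists\<close>. Later arguments see it only through
  \<open>bop_apply_rank_one\<close>.\<close>

definition rank_one :: "'h::complex_hilbert_space \<Rightarrow> 'h \<Rightarrow> 'h bop"
  where "rank_one x y = (SOME T. \<forall>z. bop_apply T z = cinner y z *\<^sub>C x)"

lemma bop_apply_rank_one: "bop_apply (rank_one x y) z = cinner y z *\<^sub>C (x :: 'h::complex_hilbert_space)"
proof -
  have "\<exists>T. \<forall>z. bop_apply T z = cinner y z *\<^sub>C x"
  proof (rule bop_exists)
    show "norm (cinner y z *\<^sub>C x) \<le> (norm x * norm y) * norm z" for z
      using mult_right_mono[OF norm_cinner_le[of y z], of "norm x"]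
      by (simp add: norm_scaleC mult_ac)
  qed (simp_all add: cinner_add_right cinner_scaleC_right scaleC_add_left scaleC_scaleC)
  then show ?thesis unfolding rank_one_def by (rule someI2_ex) blast
qed

lemma norm_rank_one_le: "norm (rank_one x y) \<le> norm x * norm (y :: 'h::complex_hilbert_space)"
proof (rule norm_bop_bound)
  show "norm (bop_apply (rank_one x y) z) \<le> norm x * norm y * norm z" for z
    using mult_right_mono[OF norm_cinner_le[of y z], of "norm x"]
    by (simp add: bop_apply_rank_one norm_scaleC mult_ac)
qed simp

lemma star_rank_one: "star (rank_one x y) = rank_one y (x :: 'h::complex_hilbert_space)"
proof (intro bop_eqI cinner_ext)
  fix v w :: 'h
  show "cinner (bop_apply (star (rank_one x y)) v) w = cinner (bop_apply (rank_one y x) v) w"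
    unfolding cinner_star_left bop_apply_rank_one cinner_scaleC_right cinner_scaleC_left
    by (simp flip: cinner_commute[of v x])
qed

text \<open>Commutation is tested on \<open>rank_one z e\<close>: applied to \<open>e\<close>, one
  product gives \<open>T z\<close> and the other gives \<open>z\<close> multiplied by the fixed
  coefficient of \<open>T e\<close> along \<open>e\<close>.\<close>

lemma central_bop_scalar:
  fixes T :: "'h::complex_hilbert_space bop"
  assumes comm: "\<And>S. T * S = S * T" and e: "norm e = 1"
  shows "T = cinner e (bop_apply T e) *\<^sub>C 1"
proof (rule bop_eqI)
  fix z
  have "bop_apply (T * rank_one z e) e = bop_apply (rank_one z e * T) e" by (simp add: comm)
  then show "bop_apply T z = bop_apply (cinner e (bop_apply T e) *\<^sub>C 1) z"
    using e by (simp add: bop_simps bop_apply_rank_one cinner_self scaleC_one)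
qed

section \<open>Orthonormal sequences\<close>

definition orthonormal :: "(nat \<Rightarrow> 'h::complex_hilbert_space) \<Rightarrow> bool"
  where "orthonormal u \<longleftrightarrow> (\<forall>p q. cinner (u p) (u q) = (if p = q then 1 else 0))"

lemma norm_orthonormal: "orthonormal u \<Longrightarrow> norm (u p) = 1"
  by (simp add: orthonormal_def norm_eq_sqrt_cinner)

lemma norm_sum_orthonormal:
  assumes u: "orthonormal u" and A: "finite A"
  shows "(norm (\<Sum>p\<in>A. c p *\<^sub>C u p))\<^sup>2 = (\<Sum>p\<in>A. (cmod (c p))\<^sup>2)"
proof -
  have "cinner (\<Sum>p\<in>A. c p *\<^sub>C u p) (\<Sum>p\<in>A. c p *\<^sub>C u p)
      = (\<Sum>p\<in>A. \<Sum>q\<in>A. cnj (c p) * (c q * (if p = q then 1 else 0)))"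
    using u by (subst cinner_sum_left)
      (simp add: cinner_sum_right cinner_scaleC_left cinner_scaleC_right orthonormal_def sum_distrib_left
        mult.left_commute)
  also have "\<dots> = (\<Sum>p\<in>A. cnj (c p) * c p)"
    using A by (intro sum.cong refl) (simp add: if_distrib[of "\<lambda>x. _ * x"] cong: if_cong)
  also have "\<dots> = complex_of_real (\<Sum>p\<in>A. (cmod (c p))\<^sup>2)"
    by (simp add: complex_norm_square mult.commute del: of_real_power)
  finally show ?thesis by (simp add: cinner_self flip: of_real_power of_real_sum)
qed

text \<open>Pythagoras: the remainder of \<open>z\<close> is orthogonal to each \<open>u q\<close>
  with \<open>q\<close> in \<open>A\<close>, hence to the partial expansion.\<close>

lemma norm_split_sum_orthonormal:
  assumes u: "orthonormal u" and A: "finite A"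
  shows "(norm z)\<^sup>2 = (\<Sum>p\<in>A. (cmod (cinner (u p) z))\<^sup>2) + (norm (z - (\<Sum>p\<in>A. cinner (u p) z *\<^sub>C u p)))\<^sup>2"
proof -
  define w where "w = (\<Sum>p\<in>A. cinner (u p) z *\<^sub>C u p)"
  have ort: "cinner (u q) (z - w) = 0" if "q \<in> A" for q
  proof -
    have "cinner (u q) w = (\<Sum>p\<in>A. if p = q then cinner (u p) z else 0)"
      using u unfolding w_def cinner_sum_right cinner_scaleC_right
      by (intro sum.cong refl) (auto simp: orthonormal_def)
    then show ?thesis using A that by (simp add: cinner_diff_right)
  qed
  have "cinner w (z - w) = (\<Sum>p\<in>A. cnj (cinner (u p) z) * cinner (u p) (z - w))"
    unfolding w_def by (simp add: cinner_sum_left cinner_scaleC_left)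
  also have "\<dots> = 0" using ort by simp
  finally have "cinner w (z - w) = 0" .
  then have "(norm z)\<^sup>2 = (norm w)\<^sup>2 + (norm (z - w))\<^sup>2"
    using norm_add_sq[of w "z - w"] by simp
  then show ?thesis
    using norm_sum_orthonormal[OF u A, of "\<lambda>p. cinner (u p) z"] by (simp add: w_def)
qed

lemma bessel:
  assumes "orthonormal u" "finite A"
  shows "(\<Sum>p\<in>A. (cmod (cinner (u p) z))\<^sup>2) \<le> (norm z)\<^sup>2"
  using norm_split_sum_orthonormal[OF assms, of z] by simp

text \<open>By Bessel the squared coefficients are summable. The norm of a block of the series over
  \<open>v\<close> depends only on these squares, so the Cauchy criterion carries over.\<close>

lemma summable_orthonormal:
  assumes u: "orthonormal u" and v: "orthonormal v"
  shows "summable (\<lambda>p. cinner (u p) z *\<^sub>C v p)"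
  unfolding summable_Cauchy
proof (intro allI impI)
  fix e :: real assume e: "e > 0"
  have "summable (\<lambda>p. (cmod (cinner (u p) z))\<^sup>2)"
    by (rule summableI_nonneg_bounded[where x = "(norm z)\<^sup>2"]) (simp_all add: bessel[OF u])
  then obtain N where N: "\<And>m n. m \<ge> N \<Longrightarrow> norm (\<Sum>p\<in>{m..<n}. (cmod (cinner (u p) z))\<^sup>2) < e\<^sup>2"
    using e unfolding summable_Cauchy by (metis zero_less_power)
  have "norm (\<Sum>p\<in>{m..<n}. cinner (u p) z *\<^sub>C v p) < e" if "m \<ge> N" for m n
  proof -
    have "(norm (\<Sum>p\<in>{m..<n}. cinner (u p) z *\<^sub>C v p))\<^sup>2 < e\<^sup>2"
      using N[OF that, of n] by (simp add: norm_sum_orthonormal[OF v] sum_nonneg)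
    then show ?thesis by (rule power2_less_imp_less) (use e in simp)
  qed
  then show "\<exists>N. \<forall>m\<ge>N. \<forall>n. norm (\<Sum>p\<in>{m..<n}. cinner (u p) z *\<^sub>C v p) < e" by blast
qed

text \<open>The partial isometry from the closed span of \<open>u\<close> to that of
  \<open>v\<close>. It serves twice: with two different sequences for the far shift, and with
  \<open>u = v\<close> as an orthogonal projection.\<close>

lemma orthonormal_operator_exists:
  fixes u v :: "nat \<Rightarrow> 'h::complex_hilbert_space"
  assumes u: "orthonormal u" and v: "orthonormal v"
  shows "\<exists>T. norm T \<le> 1 \<and> (\<forall>p. bop_apply T (u p) = v p) \<and> (\<forall>p. bop_apply (star T) (v p) = u p)
    \<and> (\<forall>z. (\<forall>p. cinner (u p) z = 0) \<longrightarrow> bop_apply T z = 0)"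
proof -
  let ?g = "\<lambda>z. \<Sum>p. cinner (u p) z *\<^sub>C v p"
  note summ = summable_orthonormal[OF u v]
  have bl: "bounded_linear (\<lambda>x::'h. c *\<^sub>C x)" for c
    by (rule bounded_linear_intro[where K = "cmod c"])
      (simp_all add: scaleC_add_right scaleR_scaleC scaleC_scaleC norm_scaleC mult.commute)
  have bound: "norm (?g z) \<le> 1 * norm z" for z
  proof -
    have "norm (\<Sum>p<n. cinner (u p) z *\<^sub>C v p) \<le> norm z" for n
      by (rule power2_le_imp_le) (simp_all add: norm_sum_orthonormal[OF v] bessel[OF u])
    then show ?thesis
      using LIMSEQ_le_const2[OF tendsto_norm[OF summable_LIMSEQ[OF summ]]] by auto
  qed
  have "\<exists>T. \<forall>z. bop_apply T z = ?g z"
  proof (rule bop_exists[OF _ _ bound])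
    show "?g (x + y) = ?g x + ?g y" for x y
      by (simp add: suminf_add[OF summ summ] cinner_add_right scaleC_add_left)
    show "?g (c *\<^sub>C x) = c *\<^sub>C ?g x" for c x
      by (simp add: bounded_linear.suminf[OF bl summ] cinner_scaleC_right scaleC_scaleC)
  qed
  then obtain T where T: "\<And>z. bop_apply T z = ?g z" by blast
  have "norm T \<le> 1" using bound by (intro norm_bop_bound) (simp_all add: T)
  moreover have "bop_apply T (u p) = v p" for p
  proof -
    have "?g (u p) = (\<Sum>q\<in>{p}. cinner (u q) (u p) *\<^sub>C v q)"
      using u by (intro suminf_finite) (auto simp: orthonormal_def)
    then show ?thesis using u by (simp add: T orthonormal_def scaleC_one)
  qed
  moreover have "bop_apply (star T) (v p) = u p" for p
  proof (rule cinner_ext)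
    fix z
    have "cinner (v p) (?g z) = (\<Sum>q. cinner (v p) (cinner (u q) z *\<^sub>C v q))"
      by (rule bounded_linear.suminf[OF bounded_linear_cinner_right summ])
    also have "\<dots> = (\<Sum>q\<in>{p}. cinner (v p) (cinner (u q) z *\<^sub>C v q))"
      using v by (intro suminf_finite) (auto simp: orthonormal_def cinner_scaleC_right)
    also have "\<dots> = cinner (u p) z"
      using v by (simp add: orthonormal_def cinner_scaleC_right)
    finally show "cinner (bop_apply (star T) (v p)) z = cinner (u p) z"
      by (simp add: cinner_star_left T)
  qed
  moreover have "bop_apply T z = 0" if "\<forall>p. cinner (u p) z = 0" for z
    using that by (simp add: T)
  ultimately show ?thesis by blast
qed

text \<open>Gram-Schmidt along a dense sequence \<open>d\<close>. Every stage must produce a new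
  unit vector, even when \<open>d n\<close> already lies in the span reached so far; infinite
  dimension supplies one.\<close>

lemma orthonormal_basis_exists:
  assumes sep: "separable_space (euclidean :: 'h::complex_hilbert_space topology)"
    and inf: "\<not> (\<exists>B::'h set. finite B \<and> complex_vector.span B = UNIV)"
  shows "\<exists>e. orthonormal e \<and> (\<forall>z::'h. (\<lambda>n. \<Sum>p<n. cinner (e p) z *\<^sub>C e p) \<longlonglongrightarrow> z)"
proof -
  obtain C :: "'h set" where C: "countable C" "closure C = UNIV"
    using sep unfolding separable_space_def by auto
  then have "C \<noteq> {}" by auto
  then obtain d :: "nat \<Rightarrow> 'h" where d: "range d = C"
    using C(1) by (metis uncountable_def)
  \<comment> \<open>The last clause puts \<open>d n\<close> in the span of the first
    \<open>n\<close> vectors together with \<open>r\<close>.\<close>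
  define P where "P f n r \<longleftrightarrow> norm r = 1 \<and> (\<forall>j<n. cinner (f j) r = 0) \<and>
     d n = (\<Sum>j<n. cinner (f j) (d n) *\<^sub>C f j) + cinner r (d n) *\<^sub>C r" for f n and r :: 'h
  have "\<exists>e. \<forall>n. P e n (e n)"
  proof (rule dependent_wellorder_choice)
    show "P f n r = P g n r" if "\<And>y. y < n \<Longrightarrow> f y = g y" for r f g n
      using that unfolding P_def by auto
    show "\<exists>r. P f n r" if prev: "\<And>y. y < n \<Longrightarrow> P f y (f y)" for n f
    proof -
      have lt: "cinner (f i) (f j) = 0" if "i < j" "j < n" for i j
        using prev[of j] that by (simp add: P_def)
      have on: "cinner (f i) (f j) = (if i = j then 1 else 0)" if "i < n" "j < n" for i j
        using that lt[of i j] lt[of j i] prev[of j]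
        by (cases i j rule: linorder_cases)
          (auto simp: cinner_eq_zero_commute[of "f i"] cinner_self P_def)
      define res where "res v = v - (\<Sum>j<n. cinner (f j) v *\<^sub>C f j)" for v
      have res: "cinner (f i) (res v) = 0" if "i < n" for i v
      proof -
        have "(\<Sum>j<n. cinner (f j) v * cinner (f i) (f j)) = (\<Sum>j<n. if j = i then cinner (f j) v else 0)"
          using that by (intro sum.cong refl) (auto simp: on)
        then show ?thesis
          using that by (simp add: res_def cinner_diff_right cinner_sum_right cinner_scaleC_right)
      qed
      have "\<exists>v. res v \<noteq> 0"
      proof (rule ccontr)
        assume "\<nexists>v. res v \<noteq> 0"
        then have "v = (\<Sum>j<n. cinner (f j) v *\<^sub>C f j)" for v by (simp add: res_def)
        then have "v \<in> complex_vector.span (f ` {..<n})" for v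
          by (metis (no_types, lifting) complex_vector.span_sum complex_vector.span_scale
              complex_vector.span_base imageI)
        then show False using inf by (metis UNIV_eq_I finite_imageI finite_lessThan)
      qed
      \<comment> \<open>The vector \<open>d n\<close> itself is orthogonalized whenever its residue
        is nonzero; otherwise any vector outside the span will do.\<close>
      then obtain v where v: "res v \<noteq> 0" and vd: "res (d n) \<noteq> 0 \<Longrightarrow> v = d n" by metis
      define r where "r = complex_of_real (1 / norm (res v)) *\<^sub>C res v"
      have r1: "norm r = 1" using v by (simp add: r_def norm_scaleC norm_divide)
      have r0: "cinner (f j) r = 0" if "j < n" for j
        using res[OF that] by (simp add: r_def cinner_scaleC_right)
      have "cinner r (d n) *\<^sub>C r = res (d n)"
      proof -
        have "cinner r (d n - res (d n)) = 0"
          using r0 unfolding res_def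
          by (simp add: cinner_sum_right cinner_scaleC_right cinner_eq_zero_commute[THEN iffD1, OF r0])
        then have eq: "cinner r (d n) = cinner r (res (d n))" by (simp add: cinner_diff_right)
        show ?thesis
        proof (cases "res (d n) = 0")
          case False
          then have "res (d n) = complex_of_real (norm (res v)) *\<^sub>C r"
            using v vd by (simp add: r_def scaleC_scaleC scaleC_one)
          then show ?thesis using r1 eq by (simp add: cinner_scaleC_right cinner_self)
        qed (simp add: eq)
      qed
      then show ?thesis using r1 r0 by (intro exI[of _ r]) (simp add: P_def res_def)
    qed
  qed
  then obtain e where e: "\<And>n. P e n (e n)" by blast
  have lt: "cinner (e i) (e j) = 0" if "i < j" for i j
    using e[of j] that by (simp add: P_def)
  have on: "orthonormal e" unfolding orthonormal_def
  proof (intro allI)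
    show "cinner (e i) (e j) = (if i = j then 1 else 0)" for i j
      using lt[of i j] lt[of j i] e[of j]
      by (cases i j rule: linorder_cases)
        (auto simp: cinner_eq_zero_commute[of "e i"] cinner_self P_def)
  qed
  have contr: "norm (w - (\<Sum>p<n. cinner (e p) w *\<^sub>C e p)) \<le> norm w" for w n
    by (rule power2_le_imp_le)
      (simp_all add: norm_split_sum_orthonormal[OF on, of "{..<n}" w] sum_nonneg)
  have exact: "(\<Sum>p<n. cinner (e p) (d k) *\<^sub>C e p) = d k" if "k < n" for k n
  proof -
    have k: "(\<Sum>p<Suc k. cinner (e p) (d k) *\<^sub>C e p) = d k"
      using e[of k] by (simp add: P_def)
    have z: "cinner (e q) (d k) = 0" if "q > k" for q
    proof -
      have "cinner (e q) (\<Sum>p<Suc k. cinner (e p) (d k) *\<^sub>C e p) = 0"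
        unfolding cinner_sum_right cinner_scaleC_right using on that
        by (intro sum.neutral) (auto simp: orthonormal_def)
      then show ?thesis unfolding k .
    qed
    have "(\<Sum>p<n. cinner (e p) (d k) *\<^sub>C e p) = (\<Sum>p<Suc k. cinner (e p) (d k) *\<^sub>C e p)"
      using that z by (intro sum.mono_neutral_right) (auto simp: not_less)
    then show ?thesis using k by simp
  qed
  have "(\<lambda>n. \<Sum>p<n. cinner (e p) z *\<^sub>C e p) \<longlonglongrightarrow> z" for z
  proof (rule metric_LIMSEQ_I)
    fix \<epsilon> :: real assume "\<epsilon> > 0"
    moreover have "z \<in> closure (range d)" using C(2) d by simp
    ultimately obtain k where k: "dist (d k) z < \<epsilon>" unfolding closure_approachable by auto
    have "dist (\<Sum>p<n. cinner (e p) z *\<^sub>C e p) z < \<epsilon>" if n: "n \<ge> Suc k" for n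
    proof -
      \<comment> \<open>Since \<open>d k\<close> equals its own partial expansion, subtracting it
        from \<open>z\<close> does not change the remainder.\<close>
      have "z - (\<Sum>p<n. cinner (e p) z *\<^sub>C e p)
          = (z - d k) - (\<Sum>p<n. cinner (e p) (z - d k) *\<^sub>C e p)"
        using exact[of k n] n
        by (simp add: cinner_diff_right complex_vector.scale_left_diff_distrib sum_subtractf)
      then have "norm (z - (\<Sum>p<n. cinner (e p) z *\<^sub>C e p)) \<le> norm (z - d k)"
        by (metis contr)
      then show ?thesis using k by (simp add: dist_norm norm_minus_commute)
    qed
    then show "\<exists>N. \<forall>n\<ge>N. dist (\<Sum>p<n. cinner (e p) z *\<^sub>C e p) z < \<epsilon>" by blast
  qed
  then show ?thesis using on by blast
qed

section \<open>Finite-dimensional compressions\<close>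

locale hilbert_basis =
  fixes e :: "nat \<Rightarrow> 'h::complex_hilbert_space"
  assumes orthonormal_basis: "orthonormal e"
    and basis_expansion: "(\<lambda>n. \<Sum>p<n. cinner (e p) z *\<^sub>C e p) \<longlonglongrightarrow> z"
begin

lemma cinner_basis: "cinner (e p) (e q) = (if p = q then 1 else 0)"
  using orthonormal_basis by (simp add: orthonormal_def)

lemma norm_basis [simp]: "norm (e p) = 1"
  by (rule norm_orthonormal[OF orthonormal_basis])

definition P :: "nat \<Rightarrow> 'h bop"
  where "P n = (\<Sum>p<n. rank_one (e p) (e p))"

abbreviation Q :: "nat \<Rightarrow> 'h bop"
  where "Q n \<equiv> 1 - P n"

lemma bop_apply_P: "bop_apply (P n) z = (\<Sum>p<n. cinner (e p) z *\<^sub>C e p)"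
  by (simp add: P_def bop_apply_sum bop_apply_rank_one)

lemma P_tendsto: "(\<lambda>n. bop_apply (P n) z) \<longlonglongrightarrow> z"
  unfolding bop_apply_P by (rule basis_expansion)

lemma P_basis: "bop_apply (P n) (e q) = (if q < n then e q else 0)"
proof -
  have "bop_apply (P n) (e q) = (\<Sum>p<n. if p = q then e p else 0)"
    unfolding bop_apply_P by (intro sum.cong refl) (simp add: cinner_basis scaleC_one)
  then show ?thesis by simp
qed

lemma star_P: "star (P n) = P n"
proof -
  have "star (\<Sum>p<n. rank_one (e p) (e p)) = (\<Sum>p<n. rank_one (e p) (e p))"
    by (induction n) (simp_all add: star_zero star_add star_rank_one)
  then show ?thesis by (simp add: P_def)
qed

lemma star_Q: "star (Q n) = Q n"
  by (simp add: star_minus star_one star_P)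

lemma bop_eq_basisI:
  assumes "\<And>p. bop_apply S (e p) = bop_apply T (e p)"
  shows "S = T"
proof (rule bop_eqI)
  fix z
  have lim: "(\<lambda>n. bop_apply S (bop_apply (P n) z)) \<longlonglongrightarrow> bop_apply S z" for S
    by (rule bounded_linear.tendsto[OF bounded_linear_bop_apply P_tendsto])
  have "bop_apply S (bop_apply (P n) z) = bop_apply T (bop_apply (P n) z)" for n
    unfolding bop_apply_P bop_linear bop_apply_scaleC assms ..
  then show "bop_apply S z = bop_apply T z"
    using LIMSEQ_unique[OF lim[of S]] lim[of T] by simp
qed

lemma P_mult_P: "P m * P n = P (min m n)"
  by (rule bop_eq_basisI) (auto simp: bop_simps P_basis bop_linear)

lemma Q_mult_Q: "Q m * Q n = Q (max m n)"
  by (rule bop_eq_basisI) (auto simp: bop_simps P_basis bop_linear)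

lemma norm_P_split: "(norm z)\<^sup>2 = (norm (bop_apply (P n) z))\<^sup>2 + (norm (bop_apply (Q n) z))\<^sup>2"
  using norm_split_sum_orthonormal[OF orthonormal_basis, of "{..<n}" z]
  by (simp add: bop_simps bop_apply_P norm_sum_orthonormal[OF orthonormal_basis])

lemma norm_P_le: "norm (P n) \<le> 1" and norm_Q_le: "norm (Q n) \<le> 1"
proof -
  have "norm (bop_apply (P n) z) \<le> norm z" "norm (bop_apply (Q n) z) \<le> norm z" for z
    using norm_P_split[of z n] by (auto intro: power2_le_imp_le)
  then show "norm (P n) \<le> 1" "norm (Q n) \<le> 1" by (simp_all add: norm_bop_bound)
qed

lemma norm_mult_Q: "norm (S * Q n) \<le> norm S" "norm (Q n * S) \<le> norm S"
  using norm_mult_ineq[of S "Q n"] norm_mult_ineq[of "Q n" S]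
    mult_left_mono[OF norm_Q_le[of n], of "norm S"] mult_right_mono[OF norm_Q_le[of n], of "norm S"]
  by simp_all

text \<open>\<open>T * P n\<close> has finite rank, so the pointwise convergence of
  \<open>Q m\<close> to zero on the finitely many vectors \<open>T (e p)\<close> already gives
  convergence in norm.\<close>

lemma norm_Q_mult_P_tendsto: "(\<lambda>m. norm (Q m * (T * P n))) \<longlonglongrightarrow> 0"
proof -
  have bound: "norm (Q m * (T * P n)) \<le> (\<Sum>p<n. norm (bop_apply (Q m) (bop_apply T (e p))))" for m
  proof (rule norm_bop_bound)
    fix z
    have "norm (bop_apply (Q m * (T * P n)) z)
        = norm (\<Sum>p<n. cinner (e p) z *\<^sub>C bop_apply (Q m) (bop_apply T (e p)))"
      unfolding bop_apply_simps(5) bop_apply_P by (simp only: bop_linear bop_apply_scaleC)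
    also have "\<dots> \<le> (\<Sum>p<n. norm z * norm (bop_apply (Q m) (bop_apply T (e p))))"
      using norm_cinner_le[of "e _" z]
      by (intro sum_norm_le) (auto simp: norm_scaleC intro!: mult_right_mono)
    finally show "norm (bop_apply (Q m * (T * P n)) z)
        \<le> (\<Sum>p<n. norm (bop_apply (Q m) (bop_apply T (e p)))) * norm z"
      by (simp add: sum_distrib_left mult.commute)
  qed (simp add: sum_nonneg)
  have "(\<lambda>m. norm (bop_apply (Q m) y)) \<longlonglongrightarrow> 0" for y
    using tendsto_norm[OF tendsto_diff[OF tendsto_const P_tendsto, of y y]] by (simp add: bop_simps)
  then have "(\<lambda>m. \<Sum>p<n. norm (bop_apply (Q m) (bop_apply T (e p)))) \<longlonglongrightarrow> 0"
    by (intro tendsto_null_sum)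
  then show ?thesis
    by (rule Lim_null_comparison[rotated]) (simp add: bound)
qed

text \<open>\<open>scalar_beyond n \<eta> b\<close> says that \<open>b\<close> is, up to \<open>\<eta>\<close>, a scalar plus an operator that lives on
  the first \<open>n\<close> basis vectors.\<close>

definition scalar_beyond :: "nat \<Rightarrow> real \<Rightarrow> 'h bop \<Rightarrow> bool"
  where "scalar_beyond n \<eta> b \<longleftrightarrow>
    (\<exists>c. norm ((b - c *\<^sub>C 1) * Q n) \<le> \<eta> \<and> norm (Q n * (b - c *\<^sub>C 1)) \<le> \<eta>)"

lemma scalar_beyond_mono:
  assumes "scalar_beyond n \<eta> b" "n \<le> m"
  shows "scalar_beyond m \<eta> b"
proof -
  obtain c where c: "norm ((b - c *\<^sub>C 1) * Q n) \<le> \<eta>" "norm (Q n * (b - c *\<^sub>C 1)) \<le> \<eta>"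
    using assms(1) unfolding scalar_beyond_def by blast
  have "(b - c *\<^sub>C 1) * Q m = (b - c *\<^sub>C 1) * Q n * Q m"
    "Q m * (b - c *\<^sub>C 1) = Q m * (Q n * (b - c *\<^sub>C 1))"
    using assms(2) by (simp_all add: Q_mult_Q mult.assoc max_def flip: mult.assoc[of "Q m"])
  then have "norm ((b - c *\<^sub>C 1) * Q m) \<le> \<eta>" "norm (Q m * (b - c *\<^sub>C 1)) \<le> \<eta>"
    using c norm_mult_Q order_trans by metis+
  then show ?thesis unfolding scalar_beyond_def by blast
qed

lemma scalar_beyond_perturb:
  assumes "scalar_beyond n \<eta> a" "norm (a - b) \<le> \<delta>"
  shows "scalar_beyond n (\<eta> + \<delta>) b"
proof -
  obtain c where c: "norm ((a - c *\<^sub>C 1) * Q n) \<le> \<eta>" "norm (Q n * (a - c *\<^sub>C 1)) \<le> \<eta>"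
    using assms(1) unfolding scalar_beyond_def by blast
  have "(b - c *\<^sub>C 1) * Q n = (a - c *\<^sub>C 1) * Q n - (a - b) * Q n"
    "Q n * (b - c *\<^sub>C 1) = Q n * (a - c *\<^sub>C 1) - Q n * (a - b)"
    by (simp_all add: left_diff_distrib right_diff_distrib)
  then have "norm ((b - c *\<^sub>C 1) * Q n) \<le> \<eta> + \<delta>" "norm (Q n * (b - c *\<^sub>C 1)) \<le> \<eta> + \<delta>"
    using c assms(2) norm_mult_Q[where S = "a - b" and n = n]
      norm_triangle_ineq4[of "(a - c *\<^sub>C 1) * Q n" "(a - b) * Q n"]
      norm_triangle_ineq4[of "Q n * (a - c *\<^sub>C 1)" "Q n * (a - b)"] by simp_all
  then show ?thesis unfolding scalar_beyond_def by blast
qed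

section \<open>Commuting with a far shift\<close>

text \<open>The isometry \<open>S\<close> carries the range of \<open>Q n\<close> into that of
  \<open>Q N\<close>, where \<open>b\<close> is close to \<open>c\<close>. Inserting
  \<open>star S * S = 1\<close> next to \<open>d = b - c\<close> and moving \<open>d\<close> across
  \<open>star S\<close> or \<open>S\<close> costs one commutator, and \<open>d\<close> has the same
  commutators as \<open>b\<close>. The scalar \<open>c\<close> is kept.\<close>

lemma scalar_beyond_of_shift:
  assumes b: "scalar_beyond N \<eta> b"
    and isom: "star S * S = 1" and norm_S: "norm S \<le> 1" and far: "Q N * (S * Q n) = S * Q n"
    and comm: "norm (b * S - S * b) \<le> \<delta>" "norm (b * star S - star S * b) \<le> \<delta>"
  shows "scalar_beyond n (\<eta> + \<delta>) b"
proof -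
  obtain c where c: "norm ((b - c *\<^sub>C 1) * Q N) \<le> \<eta>" "norm (Q N * (b - c *\<^sub>C 1)) \<le> \<eta>"
    using b unfolding scalar_beyond_def by blast
  define d where "d = b - c *\<^sub>C 1"
  have norm_S': "norm (star S) \<le> 1" using norm_S by (simp add: norm_star)
  have contr: "norm (A * T) \<le> norm T" "norm (T * A) \<le> norm T" if "norm A \<le> 1" for A T :: "'h bop"
    using norm_mult_ineq[of A T] norm_mult_ineq[of T A] that
      mult_right_mono[of "norm A" 1 "norm T"] mult_left_mono[of "norm A" 1 "norm T"] by simp_all
  have far': "Q n * star S * Q N = Q n * star S"
    using arg_cong[OF far, of star] by (simp only: star_mult star_Q)
  have d: "d * T - T * d = b * T - T * b" for T
    by (simp add: d_def left_diff_distrib right_diff_distrib mult_scaleC_left mult_scaleC_right)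
  have "d * Q n = d * (star S * S) * Q n" by (simp add: isom)
  also have "\<dots> = star S * (d * Q N) * (S * Q n) + (d * star S - star S * d) * (S * Q n)"
    unfolding mult.assoc far by (simp add: left_diff_distrib mult.assoc)
  finally have eq1: "d * Q n = star S * (d * Q N) * (S * Q n) + (b * star S - star S * b) * (S * Q n)"
    unfolding d .
  have "Q n * d = Q n * (star S * S) * d" by (simp add: isom)
  also have "\<dots> = Q n * star S * Q N * d * S - Q n * star S * (d * S - S * d)"
    unfolding far' by (simp add: right_diff_distrib mult.assoc)
  finally have eq2: "Q n * d = (Q n * star S) * (Q N * d) * S - (Q n * star S) * (b * S - S * b)"
    unfolding d by (simp add: mult.assoc)
  have SQ: "norm (S * Q n) \<le> 1" "norm (Q n * star S) \<le> 1"
    using norm_mult_Q[where S = S and n = n] norm_mult_Q[where S = "star S" and n = n] norm_S norm_S' by linarith+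
  have "norm (star S * (d * Q N) * (S * Q n)) \<le> \<eta>"
    using contr(2)[OF SQ(1)] contr(1)[OF norm_S'] c(1)[folded d_def] order_trans by metis
  moreover have "norm ((b * star S - star S * b) * (S * Q n)) \<le> \<delta>"
    using contr(2)[OF SQ(1)] comm(2) order_trans by metis
  ultimately have 1: "norm (d * Q n) \<le> \<eta> + \<delta>"
    unfolding eq1 by (intro norm_triangle_le) simp
  have "norm ((Q n * star S) * (Q N * d) * S) \<le> \<eta>"
    using contr(2)[OF norm_S] contr(1)[OF SQ(2)] c(2)[folded d_def] order_trans by metis
  moreover have "norm ((Q n * star S) * (b * S - S * b)) \<le> \<delta>"
    using contr(1)[OF SQ(2)] comm(1) order_trans by metis
  ultimately have 2: "norm (Q n * d) \<le> \<eta> + \<delta>"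
    unfolding eq2 by (intro norm_triangle_le_diff) simp
  show ?thesis using 1 2 unfolding scalar_beyond_def d_def by blast
qed

lemma shift_exists:
  assumes f: "inj f"
  shows "\<exists>S. star S * S = 1 \<and> norm S \<le> 1 \<and>
    (\<forall>n N. (\<forall>p\<ge>n. N \<le> f p) \<longrightarrow> Q N * (S * Q n) = S * Q n)"
proof -
  have "orthonormal (\<lambda>p. e (f p))"
    using f by (auto simp: orthonormal_def cinner_basis inj_eq)
  then obtain S where S: "norm S \<le> 1" "\<And>p. bop_apply S (e p) = e (f p)"
      "\<And>p. bop_apply (star S) (e (f p)) = e p"
    using orthonormal_operator_exists[OF orthonormal_basis] by blast
  have "star S * S = 1" by (rule bop_eq_basisI) (simp add: bop_simps S)
  moreover have "Q N * (S * Q n) = S * Q n" if "\<forall>p\<ge>n. N \<le> f p" for n N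
    using that by (intro bop_eq_basisI) (auto simp: bop_simps S bop_linear P_basis not_less)
  ultimately show ?thesis using S(1) by blast
qed

text \<open>Let \<open>n\<close> be the least cutoff for \<open>b i\<close> at precision \<eta>. A
  single shift \<open>S\<close> sends the basis vectors from index \<open>n - 1\<close> on beyond
  the cutoff \<open>N i\<close> for precision \<eta> / 2. Commutation with \<open>S\<close> and
  \<open>star S\<close> up to \<eta> / 2 then makes \<open>n - 1\<close> a cutoff at precision
  \<eta>, against minimality.\<close>

lemma not_escaping:
  fixes b :: "nat \<Rightarrow> 'h bop"
  assumes comm: "\<And>a. ((\<lambda>i. norm (b i * a - a * b i)) \<longlongrightarrow> 0) \<alpha>"
    and cofinite: "\<And>A. finite A \<Longrightarrow> eventually (\<lambda>i. i \<notin> A) \<alpha>" and "\<alpha> \<noteq> bot"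
    and X: "eventually (\<lambda>i. i \<in> X) \<alpha>" and \<eta>: "0 < \<eta>"
    and fin: "\<And>n. finite {i \<in> X. scalar_beyond n \<eta> (b i)}"
    and ev: "eventually (\<lambda>i. \<exists>n. scalar_beyond n (\<eta> / 2) (b i)) \<alpha>"
  shows False
proof -
  define N where "N i = (LEAST n. scalar_beyond n (\<eta> / 2) (b i))" for i
  \<comment> \<open>Using \<open>Suc p\<close> instead of \<open>p\<close> gains the one index that
    contradicts minimality. The maximum is over a finite set by \<open>fin\<close>, and the summand
    \<open>p\<close> makes \<open>f\<close> strictly increasing.\<close>
  define f where "f p = p + Max (insert 0 (N ` {i \<in> X. scalar_beyond (Suc p) \<eta> (b i)}))" for p
  have "strict_mono f"
  proof (rule strict_monoI)
    fix p q :: nat assume "p < q"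
    then have "{i \<in> X. scalar_beyond (Suc p) \<eta> (b i)} \<subseteq> {i \<in> X. scalar_beyond (Suc q) \<eta> (b i)}"
      by (auto intro: scalar_beyond_mono)
    then show "f p < f q" unfolding f_def using fin \<open>p < q\<close>
      by (intro add_less_le_mono Max_mono insert_mono image_mono) auto
  qed
  then obtain S where S: "star S * S = 1" "norm S \<le> 1"
      "\<And>n N. (\<forall>p\<ge>n. N \<le> f p) \<Longrightarrow> Q N * (S * Q n) = S * Q n"
    using shift_exists[OF strict_mono_imp_inj_on] by metis
  have small: "eventually (\<lambda>i. norm (b i * a - a * b i) < \<eta> / 2) \<alpha>" for a
    using order_tendstoD(2)[OF comm half_gt_zero[OF \<eta>]] .
  have "eventually (\<lambda>i. False) \<alpha>"
    using X cofinite[OF fin[of 0]] ev small[of S] small[of "star S"]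
  proof eventually_elim
    case (elim i)
    have Ni: "scalar_beyond (N i) (\<eta> / 2) (b i)" unfolding N_def using elim(3) by (rule LeastI_ex)
    then have "scalar_beyond (N i) (\<eta> / 2 + \<eta> / 2) (b i)"
      using scalar_beyond_perturb[of "N i" "\<eta> / 2" "b i" "b i" "\<eta> / 2"] \<eta> by simp
    then have "\<exists>n. scalar_beyond n \<eta> (b i)" by auto
    then obtain n where n: "scalar_beyond n \<eta> (b i)" "\<And>m. m < n \<Longrightarrow> \<not> scalar_beyond m \<eta> (b i)"
      using exists_least_iff[of "\<lambda>n. scalar_beyond n \<eta> (b i)"] by blast
    \<comment> \<open>The indices for which cutoff 0 works form a finite set and were discarded
      along \<alpha>.\<close>
    have "n \<noteq> 0" using elim(1,2) n(1) by (cases n) auto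
    then obtain k where k: "n = Suc k" by (cases n) auto
    have "N i \<le> f p" if "p \<ge> k" for p
    proof -
      have "scalar_beyond (Suc p) \<eta> (b i)" using n(1) that by (auto simp: k intro: scalar_beyond_mono)
      then have "N i \<le> Max (insert 0 (N ` {i \<in> X. scalar_beyond (Suc p) \<eta> (b i)}))"
        using fin elim(1) by (intro Max_ge) auto
      then show ?thesis by (simp add: f_def)
    qed
    then have "scalar_beyond k (\<eta> / 2 + \<eta> / 2) (b i)"
      using elim(4,5) by (intro scalar_beyond_of_shift[OF Ni S(1,2) S(3)]) auto
    then show False using n(2)[of k] k by simp
  qed
  then show False using \<open>\<alpha> \<noteq> bot\<close> by (simp add: eventually_False)
qed

section \<open>Total boundedness\<close>

lemma norm_P_mult_P_le:
  assumes \<delta>: "0 \<le> \<delta>"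
    and entries: "\<And>p q. p < n \<Longrightarrow> q < n \<Longrightarrow> cmod (cinner (e p) (bop_apply T (e q))) \<le> \<delta>"
  shows "norm (P n * T * P n) \<le> (real n)\<^sup>2 * \<delta>"
proof -
  have R: "rank_one (e p) (e p) * T * rank_one (e q) (e q)
      = cinner (e p) (bop_apply T (e q)) *\<^sub>C rank_one (e p) (e q)" for p q
    by (rule bop_eqI)
      (simp add: bop_simps bop_apply_rank_one cinner_scaleC_right scaleC_scaleC mult.commute)
  have R1: "norm (cinner (e p) (bop_apply T (e q)) *\<^sub>C rank_one (e p) (e q)) \<le> \<delta>"
    if "p < n" "q < n" for p q
    using mult_mono[OF entries[OF that] norm_rank_one_le[of "e p" "e q"]] \<delta>
    by (simp add: norm_scaleC_eq)
  have "P n * T * P n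
      = (\<Sum>p<n. \<Sum>q<n. cinner (e p) (bop_apply T (e q)) *\<^sub>C rank_one (e p) (e q))"
    by (simp only: P_def sum_distrib_left sum_distrib_right R)
      (rule sum.swap)
  also have "norm \<dots> \<le> (\<Sum>p<n. \<Sum>q<n. \<delta>)"
    using R1 by (intro sum_norm_le) auto
  also have "\<dots> = (real n)\<^sup>2 * \<delta>" by (simp add: power2_eq_square)
  finally show ?thesis .
qed

text \<open>Split \<open>T = a - b\<close> into \<open>P n * T * P n\<close>,
  \<open>Q n * T * P n\<close> and \<open>T * Q n\<close>. The entries control the first part; the
  other two are within \<open>2 * \<eta>\<close> of multiples of \<open>Q n\<close> by the
  difference of the two scalars. The diagonal entry at \<open>n\<close>, the first index beyond the
  cutoff, bounds that difference, so indices run up to \<open>n\<close> inclusively.\<close>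

lemma norm_diff_le_entries:
  assumes a: "scalar_beyond n \<eta> a" and b: "scalar_beyond n \<eta> b" and \<delta>: "0 \<le> \<delta>"
    and entries: "\<And>p q. p \<le> n \<Longrightarrow> q \<le> n \<Longrightarrow> cmod (cinner (e p) (bop_apply (a - b) (e q))) \<le> \<delta>"
  shows "norm (a - b) \<le> 8 * \<eta> + ((real n)\<^sup>2 + 2) * \<delta>"
proof -
  obtain c c' where
      A: "norm ((a - c *\<^sub>C 1) * Q n) \<le> \<eta>" "norm (Q n * (a - c *\<^sub>C 1)) \<le> \<eta>" and
      B: "norm ((b - c' *\<^sub>C 1) * Q n) \<le> \<eta>" "norm (Q n * (b - c' *\<^sub>C 1)) \<le> \<eta>"
    using a b unfolding scalar_beyond_def by blast
  define T where "T = a - b"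
  define \<gamma> where "\<gamma> = c - c'"
  have scal: "norm (c *\<^sub>C Q n) \<le> cmod c" for c
    using mult_left_mono[OF norm_Q_le[of n], of "cmod c"] by (simp add: norm_scaleC_eq)
  have "T * Q n - \<gamma> *\<^sub>C Q n = (a - c *\<^sub>C 1) * Q n - (b - c' *\<^sub>C 1) * Q n"
    by (simp add: T_def \<gamma>_def left_diff_distrib mult_scaleC_left
        complex_vector.scale_left_diff_distrib)
  then have TQ: "norm (T * Q n - \<gamma> *\<^sub>C Q n) \<le> 2 * \<eta>"
    using norm_triangle_ineq4[of "(a - c *\<^sub>C 1) * Q n" "(b - c' *\<^sub>C 1) * Q n"] A(1) B(1) by simp
  have "Q n * T - \<gamma> *\<^sub>C Q n = Q n * (a - c *\<^sub>C 1) - Q n * (b - c' *\<^sub>C 1)"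
    by (simp add: T_def \<gamma>_def right_diff_distrib mult_scaleC_right
        complex_vector.scale_left_diff_distrib)
  then have QT: "norm (Q n * T - \<gamma> *\<^sub>C Q n) \<le> 2 * \<eta>"
    using norm_triangle_ineq4[of "Q n * (a - c *\<^sub>C 1)" "Q n * (b - c' *\<^sub>C 1)"] A(2) B(2) by simp
  have "cinner (e n) (bop_apply (T * Q n - \<gamma> *\<^sub>C Q n) (e n)) = cinner (e n) (bop_apply T (e n)) - \<gamma>"
    by (simp add: bop_simps P_basis bop_linear cinner_diff_right cinner_scaleC_right cinner_basis)
  moreover have "cmod (cinner (e n) (bop_apply (T * Q n - \<gamma> *\<^sub>C Q n) (e n))) \<le> 2 * \<eta>"
    using norm_cinner_le[of "e n" "bop_apply (T * Q n - \<gamma> *\<^sub>C Q n) (e n)"]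
      norm_bop_apply[of "T * Q n - \<gamma> *\<^sub>C Q n" "e n"] TQ by simp
  moreover have "cmod (cinner (e n) (bop_apply T (e n))) \<le> \<delta>" unfolding T_def by (rule entries) auto
  ultimately have \<gamma>: "cmod \<gamma> \<le> 2 * \<eta> + \<delta>"
    using norm_triangle_ineq4[of "cinner (e n) (bop_apply T (e n))"
        "cinner (e n) (bop_apply T (e n)) - \<gamma>"] by simp
  have "norm (T * Q n) \<le> 2 * \<eta> + cmod \<gamma>"
    using norm_triangle_ineq[of "T * Q n - \<gamma> *\<^sub>C Q n" "\<gamma> *\<^sub>C Q n"] TQ scal[of \<gamma>] by simp
  moreover have "norm (Q n * T * P n) \<le> 2 * \<eta> + cmod \<gamma>"
  proof -
    have "norm (Q n * T * P n) \<le> norm (Q n * T)"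
      using norm_mult_ineq[of "Q n * T" "P n"] mult_left_mono[OF norm_P_le[of n], of "norm (Q n * T)"]
      by simp
    then show ?thesis
      using norm_triangle_ineq[of "Q n * T - \<gamma> *\<^sub>C Q n" "\<gamma> *\<^sub>C Q n"] QT scal[of \<gamma>] by simp
  qed
  moreover have "norm (P n * T * P n) \<le> (real n)\<^sup>2 * \<delta>"
    using entries unfolding T_def[symmetric] by (intro norm_P_mult_P_le[OF \<delta>]) auto
  moreover have "T = P n * T * P n + Q n * T * P n + T * Q n"
    by (simp add: left_diff_distrib right_diff_distrib)
  then have "norm T \<le> norm (P n * T * P n) + norm (Q n * T * P n) + norm (T * Q n)"
    by (metis norm_triangle_ineq norm_triangle_mono order_refl)
  ultimately show ?thesis using \<gamma> by (simp add: T_def algebra_simps)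
qed

text \<open>Total boundedness in the form of a coloring with finitely many colors: the matrix
  entries up to index \<open>n\<close> are rounded to a grid, and
  \<open>norm_diff_le_entries\<close> compares operators of equal color.\<close>

lemma finite_partition:
  fixes b :: "nat \<Rightarrow> 'h bop"
  assumes bound: "\<And>i. norm (b i) \<le> K" and \<eta>: "0 < \<eta>"
  obtains g :: "nat \<Rightarrow> nat \<times> nat \<times> bool \<Rightarrow> int" where "finite (range g)"
    "\<And>i j. g i = g j \<Longrightarrow> scalar_beyond n \<eta> (b i) \<Longrightarrow> scalar_beyond n \<eta> (b j) \<Longrightarrow>
      norm (b i - b j) \<le> 9 * \<eta>"
proof -
  \<comment> \<open>With this mesh, entries that agree up to \<open>2 * \<delta>\<close> contribute
    exactly \<eta>, in addition to the \<open>8 * \<eta>\<close> of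
    \<open>norm_diff_le_entries\<close>.\<close>
  define \<delta> where "\<delta> = \<eta> / (2 * ((real n)\<^sup>2 + 2))"
  have pos: "(real n)\<^sup>2 + 2 > 0" by (simp add: add_nonneg_pos)
  then have \<delta>: "\<delta> > 0" "((real n)\<^sup>2 + 2) * (2 * \<delta>) = \<eta>" using \<eta> by (simp_all add: \<delta>_def field_simps)
  define entry where "entry i p q = cinner (e p) (bop_apply (b i) (e q))" for i p q
  define D where "D = {..n} \<times> {..n} \<times> (UNIV :: bool set)"
  \<comment> \<open>The boolean selects the real or the imaginary part of the entry.\<close>
  define h where "h i = (\<lambda>(p, q, s). \<lfloor>(if s then Re (entry i p q) else Im (entry i p q)) / \<delta>\<rfloor>)" for i
  define g where "g i = restrict (h i) D" for i
  have "cmod (entry i p q) \<le> K" for i p q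
    using norm_cinner_le[of "e p" "bop_apply (b i) (e q)"] norm_bop_apply[of "b i" "e q"] bound[of i]
    by (simp add: entry_def)
  then have ReIm: "\<bar>Re (entry i p q)\<bar> \<le> K" "\<bar>Im (entry i p q)\<bar> \<le> K" for i p q
    using abs_Re_le_cmod[of "entry i p q"] abs_Im_le_cmod[of "entry i p q"] order_trans by blast+
  have "h i x \<in> {\<lfloor>- K / \<delta>\<rfloor>..\<lfloor>K / \<delta>\<rfloor>}" for i x
  proof -
    have "- K / \<delta> \<le> t / \<delta> \<and> t / \<delta> \<le> K / \<delta>" if "\<bar>t\<bar> \<le> K" for t
      using that \<delta>(1) by (intro conjI divide_right_mono) auto
    then have "\<lfloor>t / \<delta>\<rfloor> \<in> {\<lfloor>- K / \<delta>\<rfloor>..\<lfloor>K / \<delta>\<rfloor>}" if "\<bar>t\<bar> \<le> K" for t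
      using that by (meson atLeastAtMost_iff floor_mono)
    then show ?thesis using ReIm unfolding h_def by (cases x) (auto simp only: prod.case split: if_split)
  qed
  then have "range g \<subseteq> PiE D (\<lambda>_. {\<lfloor>- K / \<delta>\<rfloor>..\<lfloor>K / \<delta>\<rfloor>})"
    unfolding g_def by auto
  moreover have "finite (PiE D (\<lambda>_. {\<lfloor>- K / \<delta>\<rfloor>..\<lfloor>K / \<delta>\<rfloor>}))"
    by (rule finite_PiE) (simp_all add: D_def)
  ultimately have "finite (range g)" by (rule finite_subset)
  moreover have "norm (b i - b j) \<le> 9 * \<eta>"
    if "g i = g j" and sc: "scalar_beyond n \<eta> (b i)" "scalar_beyond n \<eta> (b j)" for i j
  proof -
    have "cmod (cinner (e p) (bop_apply (b i - b j) (e q))) \<le> 2 * \<delta>" if pq: "p \<le> n" "q \<le> n" for p q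
    proof -
      have hh: "h i (p, q, s) = h j (p, q, s)" for s
        using fun_cong[OF \<open>g i = g j\<close>, of "(p, q, s)"] pq by (simp add: g_def D_def)
      have fl: "\<bar>x - y\<bar> < \<delta>" if "\<lfloor>x / \<delta>\<rfloor> = \<lfloor>y / \<delta>\<rfloor>" for x y
      proof -
        have "\<bar>x / \<delta> - y / \<delta>\<bar> < 1" using that by linarith
        then show ?thesis using \<delta>(1) by (simp add: abs_divide flip: diff_divide_distrib)
      qed
      have "\<bar>Re (entry i p q - entry j p q)\<bar> < \<delta>" "\<bar>Im (entry i p q - entry j p q)\<bar> < \<delta>"
        using hh[of True] hh[of False] by (auto simp: h_def intro: fl)
      moreover have "cinner (e p) (bop_apply (b i - b j) (e q)) = entry i p q - entry j p q"
        by (simp add: entry_def bop_simps cinner_diff_right)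
      ultimately show ?thesis using cmod_le[of "entry i p q - entry j p q"] by simp
    qed
    then have "norm (b i - b j) \<le> 8 * \<eta> + ((real n)\<^sup>2 + 2) * (2 * \<delta>)"
      using \<delta>(1) by (intro norm_diff_le_entries sc) auto
    then show ?thesis by (simp only: \<delta>(2))
  qed
  ultimately show thesis using that by blast
qed

section \<open>Scalars modulo the compact operators\<close>

text \<open>Finite support is demanded so that vectors chosen for successive operators can occupy
  disjoint blocks of the basis.\<close>

definition supported :: "nat \<Rightarrow> 'h \<Rightarrow> bool"
  where "supported n z \<longleftrightarrow> bop_apply (P n) z = 0 \<and> (\<exists>m. bop_apply (P m) z = z)"

lemma P_apply_P: "bop_apply (P m) (bop_apply (P n) z) = bop_apply (P (min m n)) z"
  by (simp flip: bop_apply_simps(5) P_mult_P)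

lemma P_fixed_mono: "bop_apply (P m) z = z \<Longrightarrow> m \<le> m' \<Longrightarrow> bop_apply (P m') z = z"
  by (metis P_apply_P min.absorb2)

lemma P_zero_mono: "bop_apply (P m) z = 0 \<Longrightarrow> m' \<le> m \<Longrightarrow> bop_apply (P m') z = 0"
  by (metis P_apply_P min.absorb1 bop_linear(1))

lemma cinner_P_left: "cinner (bop_apply (P n) x) y = cinner x (bop_apply (P n) y)"
  by (metis cinner_star_left star_P)

lemma cinner_Q_left: "cinner (bop_apply (Q n) x) y = cinner x (bop_apply (Q n) y)"
  by (metis cinner_star_left star_Q)

lemma supported_scaleC: "supported n z \<Longrightarrow> supported n (c *\<^sub>C z)"
  unfolding supported_def by (auto simp: bop_apply_scaleC)

lemma supported_add:
  assumes "supported n x" "supported n y"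
  shows "supported n (x + y)"
proof -
  obtain k l where kl: "bop_apply (P k) x = x" "bop_apply (P l) y = y"
    using assms unfolding supported_def by blast
  then have "bop_apply (P (max k l)) (x + y) = x + y"
    by (simp add: bop_linear P_fixed_mono[OF kl(1)] P_fixed_mono[OF kl(2)])
  then show ?thesis using assms unfolding supported_def by (auto simp: bop_linear)
qed

lemma supported_diff:
  assumes "supported n x" "supported n y"
  shows "supported n (x - y)"
  using supported_add[OF assms(1) supported_scaleC[OF assms(2), of "-1"]]
  by (simp add: scaleC_one)

lemma supported_basis: "n \<le> p \<Longrightarrow> supported n (e p)"
  unfolding supported_def by (auto simp: P_basis intro: exI[of _ "Suc p"])

lemma supported_cut: "supported n (bop_apply (P m) (bop_apply (Q n) z))"
  unfolding supported_def
  by (auto simp: bop_simps bop_linear P_apply_P min.commute min.left_commute intro!: exI[of _ m])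

lemma norm_cut_le: "norm (bop_apply (P m) (bop_apply (Q n) z)) \<le> norm z"
proof -
  have "norm (bop_apply (P m) (bop_apply (Q n) z)) \<le> norm (P m) * (norm (Q n) * norm z)"
    by (rule order_trans[OF norm_bop_apply mult_left_mono[OF norm_bop_apply norm_ge_zero]])
  also have "\<dots> \<le> 1 * (1 * norm z)"
    by (intro mult_mono norm_P_le norm_Q_le) auto
  finally show ?thesis by simp
qed

section \<open>Operators with small off-diagonal coefficients beyond a cutoff\<close>

context
  fixes b :: "'h bop" and n :: nat and \<tau> :: real
  assumes orth: "\<And>x y. supported n x \<Longrightarrow> supported n y \<Longrightarrow> norm x = 1 \<Longrightarrow> norm y = 1 \<Longrightarrow>
      cinner x y = 0 \<Longrightarrow> cmod (cinner x (bop_apply b y)) \<le> \<tau>"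
begin

lemma nearly_diagonal:
  assumes x: "supported n x" and y: "supported n y" and 0: "cinner x y = 0"
  shows "cmod (cinner x (bop_apply b y)) \<le> \<tau> * norm x * norm y"
proof (cases "x = 0 \<or> y = 0")
  case True
  then show ?thesis by (auto simp: bop_linear)
next
  case False
  then have nz: "norm x \<noteq> 0" "norm y \<noteq> 0" by auto
  let ?x = "complex_of_real (1 / norm x) *\<^sub>C x" and ?y = "complex_of_real (1 / norm y) *\<^sub>C y"
  have "cmod (cinner ?x (bop_apply b ?y)) \<le> \<tau>"
    using x y 0 nz
    by (intro orth supported_scaleC)
      (simp_all add: norm_scaleC norm_divide cinner_scaleC_left cinner_scaleC_right)
  then show ?thesis using nz
    by (simp add: bop_apply_scaleC cinner_scaleC_left cinner_scaleC_right norm_mult norm_divide field_simps)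
qed

lemma tau_nonneg: "0 \<le> \<tau>"
  using nearly_diagonal[of "e n" "e (Suc n)"] norm_ge_zero
  by (simp add: supported_basis cinner_basis order_trans[OF norm_ge_zero])

text \<open>\<open>x + y\<close> and \<open>x - y\<close> are orthogonal, and by the parallelogram
  law the product of their norms is at most 2. Expanding the coefficient of \<open>b\<close> between
  them gives the difference of the diagonal values up to two off-diagonal terms, hence
  \<open>2 * \<tau> + 2 * \<tau>\<close>.\<close>

lemma diagonal_nearly_constant:
  assumes x: "supported n x" and y: "supported n y" and xy: "cinner x y = 0"
    and 1: "norm x = 1" "norm y = 1"
  shows "cmod (cinner x (bop_apply b x) - cinner y (bop_apply b y)) \<le> 4 * \<tau>"
proof -
  have yx: "cinner y x = 0" using xy cinner_eq_zero_commute by blast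
  have "cinner (x + y) (x - y) = 0"
    using xy yx 1 by (simp add: cinner_add_left cinner_diff_right cinner_self)
  then have "cmod (cinner (x + y) (bop_apply b (x - y))) \<le> \<tau> * norm (x + y) * norm (x - y)"
    by (intro nearly_diagonal supported_add supported_diff x y)
  also have "\<dots> \<le> \<tau> * 2"
  proof -
    have "2 * (norm (x + y) * norm (x - y)) \<le> (norm (x + y))\<^sup>2 + (norm (x - y))\<^sup>2"
      using sum_squares_bound[of "norm (x + y)" "norm (x - y)"] by simp
    also have "\<dots> = 4" unfolding parallelogram using 1 by simp
    finally have "norm (x + y) * norm (x - y) \<le> 2" by linarith
    then show ?thesis using tau_nonneg by (simp only: mult.assoc mult_left_mono)
  qed
  finally have "cmod (cinner (x + y) (bop_apply b (x - y))) \<le> 2 * \<tau>" by simp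
  moreover have "cinner x (bop_apply b x) - cinner y (bop_apply b y)
      = cinner (x + y) (bop_apply b (x - y)) + (cinner x (bop_apply b y) - cinner y (bop_apply b x))"
    by (simp add: bop_linear cinner_add_left cinner_diff_right)
  moreover have "cmod (cinner x (bop_apply b y) - cinner y (bop_apply b x)) \<le> \<tau> + \<tau>"
    using nearly_diagonal[OF x y xy] nearly_diagonal[OF y x yx] 1
    by (intro norm_triangle_le_diff) simp
  ultimately show ?thesis by (smt (verit) norm_triangle_ineq)
qed

text \<open>Diagonal coefficients of \<open>T\<close> are at most \<open>8 * \<tau>\<close>. For a
  general pair, splitting \<open>w\<close> along a unit vector \<open>x\<close> adds one
  off-diagonal \<tau>. The bound on finitely supported vectors then passes to the operator
  norm.\<close>

lemma cut_nearly_scalar: "norm (Q n * (b - cinner (e n) (bop_apply b (e n)) *\<^sub>C 1) * Q n) \<le> 9 * \<tau>"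
proof -
  define c where "c = cinner (e n) (bop_apply b (e n))"
  define T where "T = b - c *\<^sub>C 1"
  have diag: "cmod (cinner x (bop_apply T x)) \<le> 8 * \<tau>" if x: "supported n x" "norm x = 1" for x
  proof -
    obtain m0 where m0: "bop_apply (P m0) x = x" using x(1) unfolding supported_def by blast
    \<comment> \<open>The vector \<open>e m\<close> is orthogonal to both \<open>x\<close> and
      \<open>e n\<close>, which need not be orthogonal to each other; going through it costs
      \<open>4 * \<tau>\<close> twice.\<close>
    define m where "m = max m0 (Suc n)"
    have m: "bop_apply (P m) x = x" "n < m" using P_fixed_mono[OF m0, of m] by (simp_all add: m_def)
    have "cinner x (e m) = cinner (bop_apply (P m) x) (e m)" by (simp add: m)
    also have "\<dots> = 0" unfolding cinner_P_left by (simp add: P_basis)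
    finally have "cmod (cinner x (bop_apply b x) - cinner (e m) (bop_apply b (e m))) \<le> 4 * \<tau>"
      using m by (intro diagonal_nearly_constant x supported_basis) auto
    moreover have "cmod (cinner (e m) (bop_apply b (e m)) - c) \<le> 4 * \<tau>"
      unfolding c_def using m by (intro diagonal_nearly_constant supported_basis) (auto simp: cinner_basis)
    moreover have "cinner x (bop_apply T x) = cinner x (bop_apply b x) - c"
      using x(2) by (simp add: T_def bop_simps cinner_diff_right cinner_scaleC_right cinner_self)
    ultimately show ?thesis
      using norm_triangle_ineq[of "cinner x (bop_apply b x) - cinner (e m) (bop_apply b (e m))"
          "cinner (e m) (bop_apply b (e m)) - c"] by simp
  qed
  have unit: "cmod (cinner w (bop_apply T x)) \<le> 9 * \<tau> * norm w"
    if x: "supported n x" "norm x = 1" and w: "supported n w" for x w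
  proof -
    define v where "v = w - cinner x w *\<^sub>C x"
    have v: "supported n v" unfolding v_def by (intro supported_diff supported_scaleC x w)
    have xv: "cinner x v = 0"
      using x(2) by (simp add: v_def cinner_diff_right cinner_scaleC_right cinner_self)
    then have vx: "cinner v x = 0" using cinner_eq_zero_commute by blast
    have "(norm w)\<^sup>2 = (norm (cinner x w *\<^sub>C x))\<^sup>2 + (norm v)\<^sup>2"
      using norm_add_sq[of "cinner x w *\<^sub>C x" v] xv by (simp add: v_def cinner_scaleC_left)
    then have "norm v \<le> norm w" by (intro power2_le_imp_le[of "norm v"]) simp_all
    then have "\<tau> * norm v \<le> \<tau> * norm w" using tau_nonneg by (rule mult_left_mono)
    then have "cmod (cinner v (bop_apply T x)) \<le> \<tau> * norm w"
      using nearly_diagonal[OF v x(1) vx] x(2) vx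
      by (simp add: T_def bop_simps cinner_diff_right cinner_scaleC_right)
    moreover have "cmod (cinner (cinner x w *\<^sub>C x) (bop_apply T x)) \<le> norm w * (8 * \<tau>)"
      using mult_mono[OF norm_cinner_le[of x w] diag[OF x]] x(2)
      by (simp add: cinner_scaleC_left norm_mult)
    moreover have "cinner w (bop_apply T x)
        = cinner v (bop_apply T x) + cinner (cinner x w *\<^sub>C x) (bop_apply T x)"
      by (simp add: v_def cinner_diff_left)
    ultimately show ?thesis
      using norm_triangle_ineq[of "cinner v (bop_apply T x)" "cinner (cinner x w *\<^sub>C x) (bop_apply T x)"]
      by (simp add: algebra_simps)
  qed
  have form: "cmod (cinner w (bop_apply T x)) \<le> 9 * \<tau> * norm w * norm x"
    if x: "supported n x" and w: "supported n w" for x w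
  proof (cases "norm x = 0")
    case False
    have "cmod (cinner w (bop_apply T (complex_of_real (1 / norm x) *\<^sub>C x))) \<le> 9 * \<tau> * norm w"
      using False by (intro unit supported_scaleC x w) (simp add: norm_scaleC norm_divide)
    then show ?thesis
      using False by (simp add: bop_apply_scaleC cinner_scaleC_right norm_mult norm_divide field_simps)
  qed (simp add: bop_linear)
  have "norm (bop_apply (Q n * T * Q n) z) \<le> 9 * \<tau> * norm z" for z
  proof -
    have lim: "(\<lambda>m. bop_apply (P m) y) \<longlonglongrightarrow> y" for y by (rule P_tendsto)
    \<comment> \<open>The cutoffs \<open>P m\<close> and \<open>P l\<close> make all vectors
      finitely supported. They are removed by letting first \<open>l\<close> and then
      \<open>m\<close> tend to infinity.\<close>
    define x where "x m = bop_apply (P m) (bop_apply (Q n) z)" for m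
    have cut: "norm (bop_apply (P l) (bop_apply (Q n) (bop_apply T (x m)))) \<le> 9 * \<tau> * norm z" for l m
    proof -
      define w where "w = bop_apply (P l) (bop_apply (Q n) (bop_apply T (x m)))"
      have "cinner w w = cinner (bop_apply (Q n) (bop_apply (P l) w)) (bop_apply T (x m))"
        unfolding cinner_Q_left cinner_P_left by (simp only: w_def)
      also have "bop_apply (Q n) (bop_apply (P l) w) = w"
        unfolding w_def by (simp add: bop_simps bop_linear P_apply_P min.commute min.left_commute)
      finally have "cinner w (bop_apply T (x m)) = cinner w w" ..
      then have "(norm w)\<^sup>2 = cmod (cinner w (bop_apply T (x m)))"
        by (simp add: cinner_self norm_power)
      also have "\<dots> \<le> 9 * \<tau> * norm w * norm (x m)"
        by (intro form) (simp_all add: w_def x_def supported_cut)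
      also have "\<dots> \<le> 9 * \<tau> * norm w * norm z"
        unfolding x_def using tau_nonneg by (intro mult_left_mono norm_cut_le) simp
      finally have "norm w * norm w \<le> norm w * (9 * \<tau> * norm z)" by (simp add: power2_eq_square mult_ac)
      then show ?thesis
        using tau_nonneg by (cases "norm w = 0") (simp_all add: w_def)
    qed
    have "norm (bop_apply (Q n) (bop_apply T (x m))) \<le> 9 * \<tau> * norm z" for m
      by (rule LIMSEQ_le_const2[OF tendsto_norm[OF lim]]) (use cut in blast)
    moreover have "(\<lambda>m. bop_apply (Q n) (bop_apply T (x m))) \<longlonglongrightarrow> bop_apply (Q n) (bop_apply T (bop_apply (Q n) z))"
      unfolding x_def by (intro bounded_linear.tendsto[OF bounded_linear_bop_apply] lim)
    ultimately have "norm (bop_apply (Q n) (bop_apply T (bop_apply (Q n) z))) \<le> 9 * \<tau> * norm z"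
      by (intro LIMSEQ_le_const2[OF tendsto_norm]) auto
    then show ?thesis by (simp only: bop_apply_simps)
  qed
  then show ?thesis using tau_nonneg unfolding T_def c_def by (intro norm_bop_bound) simp_all
qed

text \<open>Beyond \<open>n\<close> the corner \<open>Q n * T * Q n\<close> is small. The remaining
  pieces involve the finite-rank operators \<open>T * P n\<close> and, after taking adjoints,
  \<open>star T * P n\<close>; a larger cutoff \<open>m\<close> brings each below \<tau>.\<close>

lemma scalar_beyond_of_nearly_diagonal:
  assumes "0 < \<tau>"
  shows "\<exists>m. scalar_beyond m (10 * \<tau>) b"
proof -
  define T where "T = b - cinner (e n) (bop_apply b (e n)) *\<^sub>C 1"
  have QTQ: "norm (Q n * T * Q n) \<le> 9 * \<tau>" unfolding T_def by (rule cut_nearly_scalar)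
  have "eventually (\<lambda>m. m \<ge> n \<and> norm (Q m * (T * P n)) < \<tau> \<and> norm (Q m * (star T * P n)) < \<tau>) sequentially"
    using order_tendstoD(2)[OF norm_Q_mult_P_tendsto \<open>0 < \<tau>\<close>] eventually_ge_at_top
    by (intro eventually_conj) auto
  then obtain m where m: "m \<ge> n" "norm (Q m * (T * P n)) < \<tau>" "norm (Q m * (star T * P n)) < \<tau>"
    unfolding eventually_sequentially by blast
  have QQ: "Q n * Q m = Q m" "Q m * Q n = Q m" using m(1) by (simp_all add: Q_mult_Q max_def)
  have "norm (P n * T * Q m) = norm (star (P n * T * Q m))" by (simp only: norm_star)
  also have "star (P n * T * Q m) = Q m * (star T * P n)" by (simp only: star_mult star_P star_Q)
  finally have PTQ: "norm (P n * T * Q m) < \<tau>" using m(3) by simp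
  have "T * Q m = Q n * T * Q n * Q m + P n * T * Q m"
    unfolding mult.assoc QQ by (simp add: left_diff_distrib)
  then have 1: "norm (T * Q m) \<le> 10 * \<tau>"
    using norm_triangle_ineq[of "Q n * T * Q n * Q m" "P n * T * Q m"] PTQ QTQ
      norm_mult_Q(1)[where S = "Q n * T * Q n" and n = m] by simp
  have "Q m * T = Q m * (Q n * T * Q n) + Q m * (T * P n)"
    unfolding mult.assoc[symmetric] QQ by (simp add: right_diff_distrib mult.assoc)
  then have 2: "norm (Q m * T) \<le> 10 * \<tau>"
    using norm_triangle_ineq[of "Q m * (Q n * T * Q n)" "Q m * (T * P n)"] m(2) QTQ
      norm_mult_Q(2)[where S = "Q n * T * Q n" and n = m] by simp
  show ?thesis using 1 2 unfolding scalar_beyond_def T_def by blast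
qed

end

section \<open>A projection that detects operators far from scalar plus compact\<close>

lemma exists_orthonormal_pair:
  assumes "0 < \<tau>" "\<And>m. \<not> scalar_beyond m (10 * \<tau>) b"
  shows "\<exists>x y. supported n x \<and> supported n y \<and> norm x = 1 \<and> norm y = 1 \<and> cinner x y = 0 \<and>
    \<tau> < cmod (cinner x (bop_apply b y))"
  using scalar_beyond_of_nearly_diagonal[of n b \<tau>] assms by (meson not_le)

text \<open>Pairs \<open>x i\<close>, \<open>y i\<close> are chosen in successive blocks of the
  basis, and \<open>a\<close> is the projection onto the closed span of all the \<open>x i\<close>.
  It kills \<open>y i\<close> and fixes \<open>x i\<close>, so the coefficient of the commutator
  between \<open>x i\<close> and \<open>y i\<close> is minus that of \<open>b i\<close>.\<close>

lemma exists_uniformly_noncommuting: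
  fixes b :: "nat \<Rightarrow> 'h bop"
  assumes \<tau>: "0 < \<tau>"
  shows "\<exists>a. \<forall>i. (\<forall>m. \<not> scalar_beyond m (10 * \<tau>) (b i)) \<longrightarrow> \<tau> < norm (b i * a - a * b i)"
proof -
  define good where "good i l m x y \<longleftrightarrow> l \<le> m \<and> bop_apply (P l) x = 0 \<and> bop_apply (P l) y = 0 \<and>
    bop_apply (P m) x = x \<and> bop_apply (P m) y = y \<and> norm x = 1 \<and> norm y = 1 \<and> cinner x y = 0 \<and>
    ((\<forall>m. \<not> scalar_beyond m (10 * \<tau>) (b i)) \<longrightarrow> \<tau> < cmod (cinner x (bop_apply (b i) y)))"
    for i l m x y
  have ex: "\<exists>m x y. good i l m x y" for i l
  proof (cases "\<forall>m. \<not> scalar_beyond m (10 * \<tau>) (b i)")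
    case True
    then obtain x y where xy: "supported l x" "supported l y" "norm x = 1" "norm y = 1" "cinner x y = 0"
        "\<tau> < cmod (cinner x (bop_apply (b i) y))"
      using exists_orthonormal_pair[OF \<tau>, of "b i" l] by auto
    obtain m1 m2 where "bop_apply (P m1) x = x" "bop_apply (P m2) y = y"
      using xy(1,2) unfolding supported_def by blast
    then have "good i l (max l (max m1 m2)) x y"
      using xy P_fixed_mono[of m1 x "max l (max m1 m2)"] P_fixed_mono[of m2 y "max l (max m1 m2)"]
      unfolding good_def supported_def by simp
    then show ?thesis by blast
  next
    case False
    \<comment> \<open>For an exceptional index two basis vectors fill the block, so that the
      recursion never stops.\<close>
    then have "good i l (l + 2) (e l) (e (l + 1))"
      unfolding good_def by (auto simp: P_basis cinner_basis)
    then show ?thesis by blast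
  qed
  \<comment> \<open>A state holds the start and end of a block and the pair inside it; each block
    starts where the previous one ends.\<close>
  have "\<exists>s. \<forall>i. (\<lambda>(l, m, x, y). good i l m x y) (s i) \<and> fst (s (Suc i)) = fst (snd (s i))"
  proof (rule dependent_nat_choice)
    show "\<exists>s. (\<lambda>(l, m, x, y). good 0 l m x y) s" using ex[of 0 0] by auto
    show "\<exists>t. (\<lambda>(l, m, x, y). good (Suc i) l m x y) t \<and> fst t = fst (snd s)" for s i
      using ex[of "Suc i" "fst (snd s)"] by auto
  qed
  then obtain s where
      "\<forall>i. (\<lambda>(l, m, x, y). good i l m x y) (s i) \<and> fst (s (Suc i)) = fst (snd (s i))" ..
  then have s: "(\<lambda>(l, m, x, y). good i l m x y) (s i)" "fst (s (Suc i)) = fst (snd (s i))" for i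
    by simp_all
  define l where "l i = fst (s i)" for i
  define x where "x i = fst (snd (snd (s i)))" for i
  define y where "y i = snd (snd (snd (s i)))" for i
  have good: "good i (l i) (l (Suc i)) (x i) (y i)" for i
    using s(1)[of i] by (simp add: l_def x_def y_def s(2) split_beta)
  have mono: "l i \<le> l j" if "i \<le> j" for i j
    by (rule lift_Suc_mono_le[OF _ that]) (use good in \<open>simp add: good_def\<close>)
  have apart: "cinner u v = 0"
    if "i < j" and u: "bop_apply (P (l (Suc i))) u = u" and v: "bop_apply (P (l j)) v = 0" for i j u v
  proof -
    have "cinner u v = cinner u (bop_apply (P (l (Suc i))) v)" using u cinner_P_left by metis
    also have "bop_apply (P (l (Suc i))) v = 0" using v \<open>i < j\<close> by (intro P_zero_mono[OF v] mono) simp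
    finally show ?thesis by simp
  qed
  have x: "orthonormal x" unfolding orthonormal_def
  proof (intro allI)
    fix i j
    show "cinner (x i) (x j) = (if i = j then 1 else 0)"
      using apart[of i j "x i" "x j"] apart[of j i "x j" "x i"] good[of i] good[of j]
      by (cases i j rule: linorder_cases)
        (auto simp: good_def cinner_self cinner_eq_zero_commute[of "x i"])
  qed
  have xy: "cinner (x j) (y i) = 0" for i j
    using apart[of i j "y i" "x j"] apart[of j i "x j" "y i"] good[of i] good[of j]
    by (cases i j rule: linorder_cases) (auto simp: good_def cinner_eq_zero_commute[of "x j"])
  obtain a where a: "\<And>p. bop_apply (star a) (x p) = x p"
      "\<And>z. (\<forall>p. cinner (x p) z = 0) \<Longrightarrow> bop_apply a z = 0"
    using orthonormal_operator_exists[OF x x] by blast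
  have "\<tau> < norm (b i * a - a * b i)" if "\<forall>m. \<not> scalar_beyond m (10 * \<tau>) (b i)" for i
  proof -
    have "bop_apply (b i * a - a * b i) (y i) = - bop_apply a (bop_apply (b i) (y i))"
      using a(2)[of "y i"] xy by (simp add: bop_simps bop_linear)
    then have "cinner (x i) (bop_apply (b i * a - a * b i) (y i)) = - cinner (x i) (bop_apply (b i) (y i))"
      by (simp add: cinner_minus_right a(1) flip: cinner_star_left)
    then have "cmod (cinner (x i) (bop_apply (b i) (y i))) = cmod (cinner (x i) (bop_apply (b i * a - a * b i) (y i)))"
      by simp
    also have "\<dots> \<le> norm (x i) * (norm (b i * a - a * b i) * norm (y i))"
      by (rule order_trans[OF norm_cinner_le mult_left_mono[OF norm_bop_apply norm_ge_zero]])
    finally show ?thesis using good[of i] that by (simp add: good_def)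
  qed
  then show ?thesis by blast
qed

lemma eventually_scalar_beyond:
  fixes b :: "nat \<Rightarrow> 'h bop"
  assumes comm: "\<And>a. ((\<lambda>i. norm (b i * a - a * b i)) \<longlongrightarrow> 0) \<alpha>" and \<eta>: "0 < \<eta>"
  shows "eventually (\<lambda>i. \<exists>n. scalar_beyond n \<eta> (b i)) \<alpha>"
proof -
  obtain a where a: "\<And>i. (\<forall>m. \<not> scalar_beyond m \<eta> (b i)) \<Longrightarrow> \<eta> / 10 < norm (b i * a - a * b i)"
    using exists_uniformly_noncommuting[of "\<eta> / 10" b] \<eta> by auto
  have "eventually (\<lambda>i. norm (b i * a - a * b i) < \<eta> / 10) \<alpha>"
    by (rule order_tendstoD(2)[OF comm]) (use \<eta> in simp)
  then show ?thesis by (rule eventually_mono) (use a in force)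
qed

end

section \<open>Ultrafilters and quasi P-points\<close>

lemma ultrafilter_not_eventually:
  assumes "nonprincipal_ultrafilter \<alpha>" "\<not> eventually P \<alpha>"
  shows "eventually (\<lambda>i. \<not> P i) \<alpha>"
proof -
  have "Collect P \<in> members \<alpha> \<or> - Collect P \<in> members \<alpha>"
    using assms(1) unfolding nonprincipal_ultrafilter_def by blast
  then show ?thesis using assms(2) by (simp add: members_def)
qed

text \<open>If some singleton belonged to \<alpha>, then \<alpha> would be the principal filter at
  its point.\<close>

lemma ultrafilter_eventually_notin:
  assumes \<alpha>: "nonprincipal_ultrafilter \<alpha>" and "finite A"
  shows "eventually (\<lambda>i. i \<notin> A) \<alpha>"
proof -
  have "eventually (\<lambda>i. i \<noteq> n) \<alpha>" for n
  proof (rule ccontr)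
    assume "\<not> eventually (\<lambda>i. i \<noteq> n) \<alpha>"
    then have n: "eventually (\<lambda>i. i = n) \<alpha>" using ultrafilter_not_eventually[OF \<alpha>] by fastforce
    have "eventually P \<alpha> \<longleftrightarrow> P n" for P
    proof
      assume "eventually P \<alpha>"
      then have "eventually (\<lambda>i. P n) \<alpha>" using n by eventually_elim simp
      then show "P n" using \<alpha> by (auto simp: nonprincipal_ultrafilter_def eventually_const_iff)
    next
      show "eventually P \<alpha>" if "P n" using n by eventually_elim (use that in simp)
    qed
    then have "\<alpha> = principal {n}" by (simp add: filter_eq_iff eventually_principal)
    then show False using \<alpha> by (simp add: nonprincipal_ultrafilter_def)
  qed
  then have "eventually (\<lambda>i. \<forall>n\<in>A. i \<noteq> n) \<alpha>" using \<open>finite A\<close> by (simp add: eventually_ball_finite)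
  then show ?thesis by (rule eventually_mono) auto
qed

lemma ultrafilter_finite_range:
  assumes \<alpha>: "nonprincipal_ultrafilter \<alpha>" and "finite (range g)"
  shows "\<exists>v. eventually (\<lambda>i. g i = v) \<alpha>"
proof (rule ccontr)
  assume "\<nexists>v. eventually (\<lambda>i. g i = v) \<alpha>"
  then have "\<forall>v\<in>range g. eventually (\<lambda>i. g i \<noteq> v) \<alpha>"
    using ultrafilter_not_eventually[OF \<alpha>] by blast
  then have "eventually (\<lambda>i. \<forall>v\<in>range g. g i \<noteq> v) \<alpha>" by (rule eventually_ball_finite[OF assms(2)])
  then have "eventually (\<lambda>i. False) \<alpha>" by (rule eventually_mono) blast
  then show False using \<alpha> by (simp add: nonprincipal_ultrafilter_def eventually_False)
qed

text \<open>Supplies the base to which the quasi P-point condition is applied; strict positivity off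
  the diagonal gives separation.\<close>

lemma metric_uniformity_base:
  fixes d :: "nat \<Rightarrow> nat \<Rightarrow> real"
  assumes refl: "\<And>i. d i i = 0" and pos: "\<And>i j. i \<noteq> j \<Longrightarrow> 0 < d i j"
    and sym: "\<And>i j. d i j = d j i" and tri: "\<And>i j k. d i k \<le> d i j + d j k"
  shows "decreasing_uniformity_base (\<lambda>k. {(i, j). d i j < 1 / real (Suc k)})"
proof -
  define E where "E k = {(i, j). d i j < 1 / real (Suc k)}" for k
  define U where "U = {V. \<exists>k. E k \<subseteq> V}"
  have dec: "decseq E"
  proof (rule decseq_SucI)
    fix k
    have "1 / real (Suc (Suc k)) \<le> 1 / real (Suc k)" by (intro divide_left_mono) simp_all
    then show "E (Suc k) \<subseteq> E k" unfolding E_def by fastforce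
  qed
  have EU: "E k \<in> U" for k unfolding U_def by blast
  have Id: "Id \<subseteq> V" if "V \<in> U" for V using that by (force simp: U_def E_def refl)
  have "separated_uniformity U" unfolding separated_uniformity_def
  proof (intro conjI ballI allI impI)
    show "U \<noteq> {}" using EU by blast
    show "W \<in> U" if "V \<in> U" "V \<subseteq> W" for V W using that unfolding U_def by blast
    show "V \<inter> W \<in> U" if "V \<in> U" "W \<in> U" for V W
    proof -
      obtain k l where kl: "E k \<subseteq> V" "E l \<subseteq> W" using \<open>V \<in> U\<close> \<open>W \<in> U\<close> unfolding U_def by blast
      have "E (max k l) \<subseteq> E k" "E (max k l) \<subseteq> E l" using dec by (simp_all add: decseqD)
      then have "E (max k l) \<subseteq> V \<inter> W" using kl by blast
      then show ?thesis unfolding U_def by blast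
    qed
    show "V\<inverse> \<in> U" if "V \<in> U" for V
    proof -
      obtain k where "E k \<subseteq> V" using \<open>V \<in> U\<close> unfolding U_def by blast
      moreover have "(i, j) \<in> E k \<longleftrightarrow> (j, i) \<in> E k" for i j using sym[of i j] by (simp add: E_def)
      ultimately have "E k \<subseteq> V\<inverse>" by auto
      then show ?thesis unfolding U_def by blast
    qed
    show "\<exists>W\<in>U. W O W \<subseteq> V" if "V \<in> U" for V
    proof -
      obtain k where k: "E k \<subseteq> V" using \<open>V \<in> U\<close> unfolding U_def by blast
      have "1 / real (Suc (2 * k + 1)) + 1 / real (Suc (2 * k + 1)) = 1 / real (Suc k)"
        by (simp add: field_simps)
      then have "d x z < 1 / real (Suc k)"
        if "d x y < 1 / real (Suc (2 * k + 1))" "d y z < 1 / real (Suc (2 * k + 1))" for x y z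
        using tri[of x z y] that by linarith
      then have "E (2 * k + 1) O E (2 * k + 1) \<subseteq> E k" unfolding E_def by blast
      then show ?thesis using k EU by blast
    qed
    show "\<Inter>U = Id"
    proof
      show "Id \<subseteq> \<Inter>U" using Id by blast
      show "\<Inter>U \<subseteq> Id"
      proof (rule subrelI, rule ccontr)
        fix i j assume ij: "(i, j) \<in> \<Inter>U" "(i, j) \<notin> Id"
        then obtain k where "1 / real (Suc k) < d i j"
          using reals_Archimedean[OF pos[of i j]] by (auto simp: inverse_eq_divide)
        moreover have "(i, j) \<in> E k" using ij EU by blast
        ultimately show False by (simp add: E_def)
      qed
    qed
  qed (use Id in auto)
  then show ?thesis
    using dec EU unfolding decreasing_uniformity_base_def E_def[symmetric] U_def by blast
qed

section \<open>Convergence along a quasi P-point\<close>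

context hilbert_basis
begin

text \<open>Each alternative leads to members of \<alpha> on which \<open>b\<close> has arbitrarily
  small diameter, the discrete one by contradiction. Completeness of the operator space then
  provides the limit.\<close>

lemma quasi_P_point_limit:
  fixes b :: "nat \<Rightarrow> 'h bop"
  assumes qP: "quasi_P_point \<alpha>"
    and bound: "\<And>i. norm (b i) \<le> K"
    and comm: "\<And>a. ((\<lambda>i. norm (b i * a - a * b i)) \<longlongrightarrow> 0) \<alpha>"
  shows "\<exists>L. (b \<longlongrightarrow> L) \<alpha>"
proof -
  have \<alpha>: "nonprincipal_ultrafilter \<alpha>" and bot: "\<alpha> \<noteq> bot"
    using qP by (simp_all add: quasi_P_point_def nonprincipal_ultrafilter_def)
  define r where "r i = 1 / real (Suc i)" for i
  \<comment> \<open>The second summand makes the uniformity separated when \<open>b\<close> is not injective.\<close>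
  define d where "d i j = norm (b i - b j) + \<bar>r i - r j\<bar>" for i j
  have "decreasing_uniformity_base (\<lambda>k. {(i, j). d i j < 1 / real (Suc k)})"
  proof (rule metric_uniformity_base)
    show "d i i = 0" for i by (simp add: d_def)
    show "0 < d i j" if "i \<noteq> j" for i j
    proof -
      have "r i \<noteq> r j" using that by (simp add: r_def)
      then show ?thesis unfolding d_def by (intro add_nonneg_pos) auto
    qed
    show "d i j = d j i" for i j by (simp add: d_def norm_minus_commute abs_minus_commute)
    show "d i k \<le> d i j + d j k" for i j k
      using norm_triangle_ineq[of "b i - b j" "b j - b k"] by (simp add: d_def)
  qed
  then consider
      (discrete) X k where "X \<in> members \<alpha>" "((X \<times> X) \<inter> {(i, j). d i j < 1 / real (Suc k)}) - Id = {}"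
    | (Cauchy) "\<forall>k. \<exists>X\<in>members \<alpha>. X \<times> X \<subseteq> {(i, j). d i j < 1 / real (Suc k)}"
    | (P_like) "\<forall>A. decreasing_to_empty \<alpha> A \<longrightarrow> (\<forall>k. \<exists>X\<in>members \<alpha>. \<forall>n.
        finite (X - {i \<in> X. \<exists>j\<in>A n. (i, j) \<in> {(i, j). d i j < 1 / real (Suc k)}}))"
    using qP unfolding quasi_P_point_def by (elim conjE allE impE) blast+
  then have "\<exists>X\<in>members \<alpha>. \<forall>i\<in>X. \<forall>j\<in>X. norm (b i - b j) < \<epsilon>" if \<epsilon>: "0 < \<epsilon>" for \<epsilon>
  proof cases
    case discrete
    define t where "t = 1 / real (Suc k)"
    define \<eta> where "\<eta> = t / 20"
    \<comment> \<open>Beyond index \<open>2 * k + 1\<close> the summand with \<open>r\<close>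
      contributes at most \<open>t / 2 = 10 * \<eta>\<close>. The separation
      \<open>t = 20 * \<eta>\<close> thus leaves norm distances above the \<open>9 * \<eta>\<close>
      of \<open>finite_partition\<close>.\<close>
    define Y where "Y = X - {..2 * k + 1}"
    have \<eta>: "0 < \<eta>" by (simp add: \<eta>_def t_def)
    have Y: "eventually (\<lambda>i. i \<in> Y) \<alpha>"
      using discrete(1) ultrafilter_eventually_notin[OF \<alpha> finite_atMost]
      by (simp add: members_def Y_def eventually_conj_iff del: atMost_iff)
    have sep: "9 * \<eta> < norm (b i - b j)" if ij: "i \<in> Y" "j \<in> Y" "i \<noteq> j" for i j
    proof -
      have r: "0 < r i \<and> r i \<le> 1 / real (2 * Suc k)" if "i \<in> Y" for i
        using that by (auto simp: Y_def r_def intro!: divide_left_mono)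
      have "\<not> d i j < t" using discrete(2) ij unfolding Y_def t_def by blast
      then have "20 * \<eta> \<le> d i j" by (simp add: \<eta>_def)
      moreover have "\<bar>r i - r j\<bar> \<le> 1 / real (2 * Suc k)" using r[OF ij(1)] r[OF ij(2)] by linarith
      moreover have "1 / real (2 * Suc k) = 10 * \<eta>" by (simp add: \<eta>_def t_def field_simps)
      ultimately show ?thesis using \<eta> by (simp add: d_def)
    qed
    have "finite {i \<in> Y. scalar_beyond n \<eta> (b i)}" for n
    proof (rule ccontr)
      assume inf: "infinite {i \<in> Y. scalar_beyond n \<eta> (b i)}" (is "infinite ?I")
      obtain g :: "nat \<Rightarrow> nat \<times> nat \<times> bool \<Rightarrow> int" where g: "finite (range g)"
          "\<And>i j. g i = g j \<Longrightarrow> scalar_beyond n \<eta> (b i) \<Longrightarrow> scalar_beyond n \<eta> (b j) \<Longrightarrow>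
            norm (b i - b j) \<le> 9 * \<eta>"
        using finite_partition[of b K \<eta> n, OF bound \<eta>] by blast
      have "finite (g ` ?I)" by (rule finite_subset[OF image_mono g(1)]) simp
      then obtain i where i: "i \<in> ?I" "infinite {j \<in> ?I. g j = g i}"
        using pigeonhole_infinite[OF inf] by blast
      then obtain j where "j \<in> {j \<in> ?I. g j = g i}" "j \<noteq> i"
        by (metis (no_types, lifting) finite.emptyI finite_insert finite_subset insertI1 subsetI)
      then show False using g(2)[of j i] sep[of j i] i(1) by fastforce
    qed
    then show ?thesis
      using not_escaping[OF comm ultrafilter_eventually_notin[OF \<alpha>] bot Y \<eta> _
          eventually_scalar_beyond[OF comm half_gt_zero[OF \<eta>]]] by blast
  next
    case Cauchy
    obtain k where k: "1 / real (Suc k) < \<epsilon>"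
      using reals_Archimedean[OF \<epsilon>] by (auto simp: inverse_eq_divide)
    obtain X where X: "X \<in> members \<alpha>" "X \<times> X \<subseteq> {(i, j). d i j < 1 / real (Suc k)}"
      using Cauchy by blast
    have "norm (b i - b j) < \<epsilon>" if "i \<in> X" "j \<in> X" for i j
    proof -
      have "d i j < 1 / real (Suc k)" using X(2) that by blast
      then show ?thesis using k unfolding d_def by linarith
    qed
    then show ?thesis using X(1) by blast
  next
    case P_like
    have "\<exists>n. eventually (\<lambda>i. scalar_beyond n \<eta> (b i)) \<alpha>" if \<eta>: "0 < \<eta>" for \<eta>
    proof (rule ccontr)
      assume none: "\<nexists>n. eventually (\<lambda>i. scalar_beyond n \<eta> (b i)) \<alpha>"
      \<comment> \<open>Removing the initial segment forces empty intersection and, as \<alpha> is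
        nonprincipal, keeps \<open>A n\<close> in \<alpha>.\<close>
      define A where "A n = {i. \<not> scalar_beyond n \<eta> (b i)} - {..<n}" for n
      have "decreasing_to_empty \<alpha> A" unfolding decreasing_to_empty_def
      proof (intro conjI allI)
        show "decseq A" unfolding A_def decseq_def by (auto intro: scalar_beyond_mono)
        show "A n \<in> members \<alpha>" for n
          using none ultrafilter_not_eventually[OF \<alpha>] ultrafilter_eventually_notin[OF \<alpha> finite_lessThan]
          by (simp add: members_def A_def eventually_conj_iff del: lessThan_iff)
        have "i \<notin> A (Suc i)" for i by (simp add: A_def)
        then show "(\<Inter>n. A n) = {}" by blast
      qed
      moreover obtain k where k: "1 / real (Suc k) < \<eta> / 2"
        using reals_Archimedean[OF half_gt_zero[OF \<eta>]] by (auto simp: inverse_eq_divide)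
      ultimately obtain X where X: "X \<in> members \<alpha>"
          "\<And>n. finite (X - {i \<in> X. \<exists>j\<in>A n. (i, j) \<in> {(i, j). d i j < 1 / real (Suc k)}})"
        using P_like by blast
      \<comment> \<open>Failure at precision \<eta> for \<open>b j\<close> passes to failure at
        \<eta> / 2 for the nearby \<open>b i\<close>. Hence on \<open>X\<close> each
        \<open>n\<close> works at \<eta> / 2 for finitely many \<open>i\<close> only, which
        \<open>not_escaping\<close> excludes.\<close>
      have "\<not> scalar_beyond n (\<eta> / 2) (b i)" if "j \<in> A n" "d i j < 1 / real (Suc k)" for i j n
      proof
        assume "scalar_beyond n (\<eta> / 2) (b i)"
        moreover have "norm (b i - b j) \<le> \<eta> / 2" using that(2) k unfolding d_def by linarith
        ultimately have "scalar_beyond n (\<eta> / 2 + \<eta> / 2) (b j)" by (rule scalar_beyond_perturb)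
        then show False using that(1) by (simp add: A_def)
      qed
      then have "finite {i \<in> X. scalar_beyond n (\<eta> / 2) (b i)}" for n
        by (intro finite_subset[OF _ X(2)[of n]]) auto
      then show False
        using not_escaping[OF comm ultrafilter_eventually_notin[OF \<alpha>] bot _ half_gt_zero[OF \<eta>] _
            eventually_scalar_beyond[OF comm], of X] X(1) \<eta> by (simp add: members_def)
    qed
    moreover have \<epsilon>10: "0 < \<epsilon> / 10" using \<epsilon> by simp
    ultimately obtain n where n: "eventually (\<lambda>i. scalar_beyond n (\<epsilon> / 10) (b i)) \<alpha>" by blast
    obtain g :: "nat \<Rightarrow> nat \<times> nat \<times> bool \<Rightarrow> int" where g: "finite (range g)"
        "\<And>i j. g i = g j \<Longrightarrow> scalar_beyond n (\<epsilon> / 10) (b i) \<Longrightarrow> scalar_beyond n (\<epsilon> / 10) (b j) \<Longrightarrow>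
          norm (b i - b j) \<le> 9 * (\<epsilon> / 10)"
      using finite_partition[of b K "\<epsilon> / 10" n, OF bound \<epsilon>10] by blast
    \<comment> \<open>With a common cutoff \<open>n\<close> fixed, the ultrafilter selects one
      color, and equal colors give distance at most \<open>9 * (\<epsilon> / 10)\<close>.\<close>
    obtain v where v: "eventually (\<lambda>i. g i = v) \<alpha>" using ultrafilter_finite_range[OF \<alpha> g(1)] by blast
    have "{i. scalar_beyond n (\<epsilon> / 10) (b i) \<and> g i = v} \<in> members \<alpha>"
      using eventually_conj[OF n v] by (simp add: members_def)
    moreover have "norm (b i - b j) < \<epsilon>"
      if "scalar_beyond n (\<epsilon> / 10) (b i) \<and> g i = v" "scalar_beyond n (\<epsilon> / 10) (b j) \<and> g j = v" for i j
      using g(2)[of i j] that \<epsilon> by simp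
    ultimately show ?thesis by (intro bexI ballI) auto
  qed
  then have "\<exists>X. eventually (\<lambda>i. i \<in> X) \<alpha> \<and> (\<forall>i j. i \<in> X \<and> j \<in> X \<longrightarrow> norm (b i - b j) < \<epsilon>)"
    if "0 < \<epsilon>" for \<epsilon>
    using that unfolding members_def by blast
  then have "cauchy_filter (filtermap b \<alpha>)"
    unfolding cauchy_filter_metric_filtermap dist_norm by blast
  moreover have "filtermap b \<alpha> \<noteq> bot" using bot by (simp add: filtermap_bot_iff)
  ultimately show ?thesis
    using complete_UNIV[where 'a = "'h bop"] unfolding complete_uniform filterlim_def by auto
qed

lemma quasi_P_point_scalar_limit:
  fixes b :: "nat \<Rightarrow> 'h bop"
  assumes qP: "quasi_P_point \<alpha>"
    and bound: "\<And>i. norm (b i) \<le> K"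
    and comm: "\<And>a. ((\<lambda>i. norm (b i * a - a * b i)) \<longlongrightarrow> 0) \<alpha>"
  shows "\<exists>c. (b \<longlongrightarrow> c *\<^sub>C 1) \<alpha>"
proof -
  have bot: "\<alpha> \<noteq> bot" using qP by (simp add: quasi_P_point_def nonprincipal_ultrafilter_def)
  obtain L where L: "(b \<longlongrightarrow> L) \<alpha>" using quasi_P_point_limit[OF assms] by blast
  have "L * a = a * L" for a
  proof -
    have "((\<lambda>i. norm (b i * a - a * b i)) \<longlongrightarrow> norm (L * a - a * L)) \<alpha>"
      by (intro tendsto_intros L)
    then have "norm (L * a - a * L) = 0" using comm bot tendsto_unique by blast
    then show ?thesis by simp
  qed
  then have "L = cinner (e 0) (bop_apply L (e 0)) *\<^sub>C 1" by (rule central_bop_scalar) simp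
  then show ?thesis using L by metis
qed

end

section \<open>The ultrapower\<close>

lemma const_seq_closed: "(\<lambda>n. a) \<in> carrier bounded_seq_ring"
  unfolding bounded_seq_carrier_iff by (intro exI[of _ "norm a"]) simp

lemma bounded_seq_ring_minus:
  fixes x y :: "nat \<Rightarrow> 'a::cstar_algebra"
  assumes x: "x \<in> carrier bounded_seq_ring" and y: "y \<in> carrier bounded_seq_ring"
  shows "x \<ominus>\<^bsub>bounded_seq_ring\<^esub> y = (\<lambda>n. x n - y n)"
proof -
  interpret R: ring "bounded_seq_ring :: (nat \<Rightarrow> 'a) ring" by (rule ring_bounded_seq_ring)
  have "(\<lambda>n. - y n) \<in> carrier bounded_seq_ring" using y by (simp add: bounded_seq_carrier_iff)
  then have "\<ominus>\<^bsub>bounded_seq_ring\<^esub> y = (\<lambda>n. - y n)"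
    using y by (intro R.minus_equality) (simp_all add: bounded_seq_ring_def)
  then show ?thesis by (simp add: a_minus_def) (simp add: bounded_seq_ring_def)
qed

lemma ultrapower_class_eq_iff:
  fixes x y :: "nat \<Rightarrow> 'a::cstar_algebra"
  assumes x: "x \<in> carrier bounded_seq_ring" and y: "y \<in> carrier bounded_seq_ring"
  shows "null_seq_ideal \<alpha> +>\<^bsub>bounded_seq_ring\<^esub> x = null_seq_ideal \<alpha> +>\<^bsub>bounded_seq_ring\<^esub> y
    \<longleftrightarrow> ((\<lambda>n. norm (x n - y n)) \<longlongrightarrow> 0) \<alpha>"
proof -
  interpret R: ring "bounded_seq_ring :: (nat \<Rightarrow> 'a) ring" by (rule ring_bounded_seq_ring)
  have "x \<ominus>\<^bsub>bounded_seq_ring\<^esub> y \<in> carrier bounded_seq_ring" using x y by (rule R.minus_closed)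
  then have "x \<ominus>\<^bsub>bounded_seq_ring\<^esub> y \<in> null_seq_ideal \<alpha> \<longleftrightarrow> ((\<lambda>n. norm (x n - y n)) \<longlongrightarrow> 0) \<alpha>"
    by (simp add: null_seq_ideal_def bounded_seq_ring_minus[OF x y])
  then show ?thesis
    using R.quotient_eq_iff_same_a_r_cos[OF ideal_null_seq_ideal x y, of \<alpha>] by blast
qed

lemma carrier_ultrapower:
  "carrier (ultrapower \<alpha>) = (\<lambda>x. null_seq_ideal \<alpha> +>\<^bsub>bounded_seq_ring\<^esub> x) ` carrier bounded_seq_ring"
  by (auto simp: ultrapower_def FactRing_def A_RCOSETS_def')

text \<open>Cosets multiply through representatives, so commuting with the class of a constant
  sequence means that the commutators tend to zero along \<alpha>. This moves the problem from the
  quotient ring to bounded sequences.\<close>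

lemma ultra_commutant_class_iff:
  fixes x :: "nat \<Rightarrow> 'a::cstar_algebra"
  assumes x: "x \<in> carrier bounded_seq_ring"
  shows "null_seq_ideal \<alpha> +>\<^bsub>bounded_seq_ring\<^esub> x \<in> ultra_commutant \<alpha>
    \<longleftrightarrow> (\<forall>a. ((\<lambda>n. norm (x n * a - a * x n)) \<longlongrightarrow> 0) \<alpha>)"
proof -
  let ?R = "bounded_seq_ring :: (nat \<Rightarrow> 'a) ring"
  interpret R: ring ?R by (rule ring_bounded_seq_ring)
  have mult: "(null_seq_ideal \<alpha> +>\<^bsub>?R\<^esub> y) \<otimes>\<^bsub>ultrapower \<alpha>\<^esub> (null_seq_ideal \<alpha> +>\<^bsub>?R\<^esub> z)
      = null_seq_ideal \<alpha> +>\<^bsub>?R\<^esub> (\<lambda>n. y n * z n)"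
    if "y \<in> carrier ?R" "z \<in> carrier ?R" for y z
    using ideal.rcoset_mult_add[OF ideal_null_seq_ideal that, of \<alpha>]
    by (simp add: ultrapower_def FactRing_def) (simp add: bounded_seq_ring_def)
  have closed: "(\<lambda>n. y n * z n) \<in> carrier ?R" if "y \<in> carrier ?R" "z \<in> carrier ?R" for y z
    using R.m_closed[OF that] by (simp add: bounded_seq_ring_def)
  have "null_seq_ideal \<alpha> +>\<^bsub>?R\<^esub> x \<in> carrier (ultrapower \<alpha>)"
    using x unfolding carrier_ultrapower by (rule imageI)
  then show ?thesis unfolding ultra_commutant_def const_class_def
    by (simp add: mult x const_seq_closed closed ultrapower_class_eq_iff)
qed

theorem theorem28:
  fixes \<alpha> :: "nat filter"
  assumes "separable_space (euclidean :: 'h::complex_hilbert_space topology)"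
    and "\<not> (\<exists>B::'h set. finite B \<and> complex_vector.span B = UNIV)"
    and "nonprincipal_ultrafilter \<alpha>"
    and "quasi_P_point \<alpha>"
  shows "(ultra_commutant \<alpha> :: (nat \<Rightarrow> 'h bop) set set) = ultra_scalars \<alpha>"
proof
  obtain e :: "nat \<Rightarrow> 'h" where "orthonormal e"
      "\<And>z. (\<lambda>n. \<Sum>p<n. cinner (e p) z *\<^sub>C e p) \<longlonglongrightarrow> z"
    using orthonormal_basis_exists[OF assms(1,2)] by blast
  then interpret hilbert_basis e by unfold_locales
  let ?N = "null_seq_ideal \<alpha> :: (nat \<Rightarrow> 'h bop) set"
  show "(ultra_commutant \<alpha> :: (nat \<Rightarrow> 'h bop) set set) \<subseteq> ultra_scalars \<alpha>"
  proof
    fix B :: "(nat \<Rightarrow> 'h bop) set" assume B: "B \<in> ultra_commutant \<alpha>"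
    then obtain x where x: "x \<in> carrier bounded_seq_ring" "B = ?N +>\<^bsub>bounded_seq_ring\<^esub> x"
      by (auto simp: ultra_commutant_def carrier_ultrapower)
    obtain K where K: "\<And>n. norm (x n) \<le> K" using x(1) by (auto simp: bounded_seq_carrier_iff)
    have "\<And>a. ((\<lambda>n. norm (x n * a - a * x n)) \<longlongrightarrow> 0) \<alpha>"
      using B x ultra_commutant_class_iff[OF x(1), of \<alpha>] by simp
    then obtain c where "(x \<longlongrightarrow> c *\<^sub>C 1) \<alpha>"
      using quasi_P_point_scalar_limit[OF assms(4), of x K] K by blast
    then have "((\<lambda>n. norm (x n - c *\<^sub>C 1)) \<longlongrightarrow> 0) \<alpha>"
      by (intro tendsto_norm_zero LIM_zero)
    then have "B = const_class \<alpha> (c *\<^sub>C 1)"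
      using x by (simp add: const_class_def ultrapower_class_eq_iff const_seq_closed)
    then show "B \<in> ultra_scalars \<alpha>" by (simp add: ultra_scalars_def)
  qed
  show "ultra_scalars \<alpha> \<subseteq> (ultra_commutant \<alpha> :: (nat \<Rightarrow> 'h bop) set set)"
    by (auto simp: ultra_scalars_def const_class_def ultra_commutant_class_iff const_seq_closed
        mult_scaleC_left mult_scaleC_right)
qed

end
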